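(* Let $A=\sum_{\alpha\in\mathbb{N}_0^n}\frac{a_\alpha}{\alpha!}\cdot\partial^\alpha$ with $a_\alpha\in\mathbb{R}[x_1,\dots,x_n]_{\leq|\alpha|}$ for all $\alpha\in\mathbb{N}_0^n$ (in particular $a_0\in\mathbb{R}$ is a constant). Then the following are equivalent: (i) $e^{tA}$ is a positivity preserver for all $t\geq 0$, i.e. $e^{tA}\mathrm{Pos}(\mathbb{R}^n)\subseteq\mathrm{Pos}(\mathbb{R}^n)$ for all $t\ge 0$; (ii) for every $y\in\mathbb{R}^n$ there exist a real symmetric matrix $\Sigma(y)=(\sigma_{i,j}(y))_{i,j=1}^n\succeq 0$, a vector $b(y)=(b_1(y),\dots,b_n(y))^T\in\mathbb{R}^n$, and a measure $\nu_y$ on $\mathbb{R}^n$ with $\int_{\|x\|_2\geq 1}|x_i|\,\mathrm{d}\nu_y(x)<\infty$ for $i=1,\dots,n$ and $\int_{\mathbb{R}^n}|x^\alpha|\,\mathrm{d}\nu_y(x)<\infty$ for all $\alpha\in\mathbb{N}_0^n$ with $|\alpha|\geq 2$, such that $a_{e_i}(y)=b_i(y)+\int_{\|x\|_2\geq 1}x_i\,\mathrm{d}\nu_y(x)$ for $i=1,\dots,n$, $a_{e_i+e_j}(y)=\sigma_{i,j}(y)+\int_{\mathbb{R}^n}x^{e_i+e_j}\,\mathrm{d}\nu_y(x)$ for all $i,j=1,\dots,n$, and $a_\alpha(y)=\int_{\mathbb{R}^n}x^\alpha\,\mathrm{d}\nu_y(x)$ for all $\alpha\in\mathbb{N}_0^n$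 with $|\alpha|\geq 3$.
   Context: $\mathrm{Pos}(\mathbb{R}^n)$ is the set of polynomials in $\mathbb{R}[x_1,\dots,x_n]$ that are non-negative on $\mathbb{R}^n$. Since each $a_\alpha$ has degree at most $|\alpha|$, $A$ maps each space $\mathbb{R}[x_1,\dots,x_n]_{\leq d}$ of polynomials of degree $\le d$ into itself, so $e^{tA}=\sum_{k\ge0}\frac{t^kA^k}{k!}$ is well-defined on $\mathbb{R}[x_1,\dots,x_n]$ (computed on each finite-dimensional space $\mathbb{R}[x_1,\dots,x_n]_{\le d}$). $e_i$ denotes the $i$-th unit vector in $\mathbb{N}_0^n$, $\alpha!=\alpha_1!\cdots\alpha_n!$. *)

theory Defs
  imports "HOL-Analysis.Analysis" "HOL-Library.Poly_Mapping" "HOL-Library.Function_Algebras"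
begin

text \<open>Real polynomials in the variables x_i, i :: 'n (a finite index type, so n = CARD('n)).
  A multi-index alpha in N_0^n is a function 'n => nat; a polynomial is a finitely
  supported map from multi-indices (monomial exponents) to real coefficients.\<close>

type_synonym 'n mpoly = "('n \<Rightarrow> nat) \<Rightarrow>\<^sub>0 real"

definition mdeg :: "('n::finite \<Rightarrow> nat) \<Rightarrow> nat" where
  "mdeg \<alpha> = (\<Sum>i\<in>UNIV. \<alpha> i)"

definition mfact :: "('n::finite \<Rightarrow> nat) \<Rightarrow> real" where
  "mfact \<alpha> = (\<Prod>i\<in>UNIV. fact (\<alpha> i))"

definition unitv :: "'n \<Rightarrow> ('n \<Rightarrow> nat)" where
  "unitv i = (\<lambda>j. if j = i then 1 else 0)"

definition mono_eval :: "('n::finite \<Rightarrow> nat) \<Rightarrow> real^'n \<Rightarrow> real" where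
  "mono_eval \<alpha> x = (\<Prod>i\<in>UNIV. (x $ i) ^ (\<alpha> i))"

definition poly_eval :: "'n::finite mpoly \<Rightarrow> real^'n \<Rightarrow> real" where
  "poly_eval p x = (\<Sum>\<alpha>\<in>Poly_Mapping.keys p. Poly_Mapping.lookup p \<alpha> * mono_eval \<alpha> x)"

definition deg_le :: "'n::finite mpoly \<Rightarrow> nat \<Rightarrow> bool" where
  "deg_le p d \<longleftrightarrow> (\<forall>\<beta>\<in>Poly_Mapping.keys p. mdeg \<beta> \<le> d)"

text \<open>Partial derivative d^alpha: d^alpha x^(gamma+alpha) = prod_i (gamma_i+alpha_i)!/gamma_i! x^gamma\<close>
definition pderivm :: "('n::finite \<Rightarrow> nat) \<Rightarrow> 'n mpoly \<Rightarrow> 'n mpoly" where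
  "pderivm \<alpha> p = Abs_poly_mapping (\<lambda>\<gamma>. Poly_Mapping.lookup p (\<lambda>i. \<gamma> i + \<alpha> i) *
       (\<Prod>i\<in>UNIV. fact (\<gamma> i + \<alpha> i) / fact (\<gamma> i)))"

text \<open>The operator A = sum_alpha a_alpha / alpha! d^alpha (a formally infinite sum, but only
  finitely many terms are nonzero on any polynomial)\<close>
definition opA :: "(('n::finite \<Rightarrow> nat) \<Rightarrow> 'n mpoly) \<Rightarrow> 'n mpoly \<Rightarrow> 'n mpoly" where
  "opA a p = Sum_any (\<lambda>\<alpha>. Poly_Mapping.map (\<lambda>c. c / mfact \<alpha>) (a \<alpha> * pderivm \<alpha> p))"

text \<open>e^{tA} p = sum_k t^k/k! A^k p, computed in the finite-dimensional space of polynomials of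
  degree <= deg p (convergence there is coefficientwise)\<close>
definition expA :: "(('n::finite \<Rightarrow> nat) \<Rightarrow> 'n mpoly) \<Rightarrow> real \<Rightarrow> 'n mpoly \<Rightarrow> 'n mpoly" where
  "expA a t p = Abs_poly_mapping (\<lambda>\<beta>. suminf (\<lambda>k. t ^ k / fact k * Poly_Mapping.lookup ((opA a ^^ k) p) \<beta>))"

definition Pos :: "'n::finite mpoly set" where
  "Pos = {p. \<forall>x. 0 \<le> poly_eval p x}"

definition psd :: "real^'n^'n \<Rightarrow> bool" where
  "psd S \<longleftrightarrow> transpose S = S \<and> (\<forall>v. 0 \<le> v \<bullet> (S *v v))"

end

theory Submission
  imports Defs "HOL-Probability.Probability"
begin

text \<open>Both conditions are equivalent to the positive minimum principle \<open>pos_min a y\<close> at every \<open>y\<close>: if a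
  polynomial \<open>q \<ge> 0\<close> vanishes at \<open>y\<close>, then \<open>(A q) y \<ge> 0\<close>. For the semigroup, one direction is the
  derivative at \<open>t = 0\<close>, the other a parabolic maximum principle with a polynomial weight of high degree.

  For the Levy triple, note that \<open>(A q) y\<close> is the sum of \<open>a\<^sub>\<alpha> y\<close> times the Taylor coefficients of \<open>q\<close> at
  \<open>y\<close>. If \<open>q \<ge> 0\<close> vanishes at \<open>y\<close>, so does its gradient, and \<open>(A q) y\<close> becomes the pairing of \<open>\<Sigma>\<close> with the
  (positive semidefinite) quadratic part of \<open>q\<close> plus the integral of \<open>q (y + x)\<close> against \<open>\<nu>\<close>. Conversely,
  the principle makes \<open>\<alpha> \<mapsto> a\<^sub>\<alpha> y\<close>, \<open>|\<alpha>| \<ge> 2\<close>, a positive functional on polynomials without terms of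
  degree below two. By separation it is approximated by finitely supported measures, which are moved to the
  real line by a space-filling curve in polar coordinates; a weak limit provided by Helly's selection
  theorem yields \<open>\<nu>\<close> away from radius zero and \<open>\<Sigma>\<close> from the mass at radius zero.\<close>

section \<open>Polynomials and Taylor coefficients\<close>

text \<open>The principle never tests a_0 and the a_{e_i}: they multiply the value and the gradient
  of q at y, which vanish. So b y has only to absorb the difference between a_{e_i} y and the
  truncated first moment.

  The difficulty lies in small jumps. As only moments of degree at least two are controlled, \<nu>
  may have infinite mass near the origin. Multiplying by |x|^2 makes the masses bounded, but for
  |\<alpha>| = 2 the function x^\<alpha> / |x|^2 has in general no continuous extension to the
  origin, so a weak limit in x alone would lose the second moments carried by vanishing jumps.
  Keeping direction and radius apart repairs this, as r^(|\<alpha>|-2) \<theta>^\<alpha> is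
  continuous up to r = 0.

  Helly's theorem concerns distribution functions on the line, so the pair (\<theta>, r) is written
  as a continuous function of a real parameter. Preimages are chosen with a parameter at most linear
  in r, so that mass cannot escape. The moments are unbounded functions of the parameter; they pass
  to the limit because moments of higher even degree are approximated as well and bound their
  squares in the mean.\<close>

definition multis :: "nat \<Rightarrow> ('n::finite \<Rightarrow> nat) set" where
  "multis d = {\<alpha>. mdeg \<alpha> \<le> d}"

definition taylor :: "'n::finite mpoly \<Rightarrow> real^'n \<Rightarrow> ('n \<Rightarrow> nat) \<Rightarrow> real" where
  "taylor q y \<alpha> = poly_eval (pderivm \<alpha> q) y / mfact \<alpha>"

definition pos_min :: "(('n::finite \<Rightarrow> nat) \<Rightarrow> 'n mpoly) \<Rightarrow> real^'n \<Rightarrow> bool" where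
  "pos_min a y \<longleftrightarrow> (\<forall>q\<in>Pos. poly_eval q y = 0 \<longrightarrow> 0 \<le> poly_eval (opA a q) y)"

abbreviation scalem :: "real \<Rightarrow> 'n::finite mpoly \<Rightarrow> 'n mpoly" where
  "scalem c \<equiv> Poly_Mapping.map ((*) c)"

section \<open>Multi-indices, evaluation and degree\<close>

lemma finite_below: "finite {\<alpha>::'n::finite \<Rightarrow> nat. \<forall>i. \<alpha> i \<le> \<gamma> i}"
proof -
  have "finite (PiE (UNIV::'n set) (\<lambda>i. {..\<gamma> i}))"
    by (intro finite_PiE) auto
  then show ?thesis
    by (simp add: PiE_UNIV_domain Pi_def)
qed

lemma le_mdeg: "\<alpha> i \<le> mdeg \<alpha>"
  unfolding mdeg_def by (intro member_le_sum) auto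

lemma finite_multis [simp]: "finite (multis d)"
  by (rule finite_subset[OF _ finite_below[of "\<lambda>_. d"]])
     (auto simp: multis_def intro: order_trans[OF le_mdeg])

lemma mdeg_add: "mdeg (\<alpha> + \<beta>) = mdeg \<alpha> + mdeg \<beta>"
  by (simp add: mdeg_def sum.distrib)

lemma mono_eval_add: "mono_eval (\<alpha> + \<beta>) x = mono_eval \<alpha> x * mono_eval \<beta> x"
  by (simp add: mono_eval_def power_add prod.distrib)

lemma mpoly_eq_sum: "p = (\<Sum>k\<in>Poly_Mapping.keys p. Poly_Mapping.single k (Poly_Mapping.lookup p k))"
  by (rule poly_mapping_eqI)
     (auto simp: lookup_sum lookup_single when_def in_keys_iff)

lemma lookup_scalem: "Poly_Mapping.lookup (scalem c p) k = c * Poly_Mapping.lookup p k"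
  by (simp add: Poly_Mapping.map.rep_eq when_def)

lemma poly_eval_superset:
  assumes "finite K" "Poly_Mapping.keys p \<subseteq> K"
  shows "poly_eval p x = (\<Sum>\<alpha>\<in>K. Poly_Mapping.lookup p \<alpha> * mono_eval \<alpha> x)"
  unfolding poly_eval_def using assms
  by (intro sum.mono_neutral_left) (auto simp: in_keys_iff)

lemma poly_eval_deg_le:
  assumes "deg_le p d"
  shows "poly_eval p x = (\<Sum>\<alpha>\<in>multis d. Poly_Mapping.lookup p \<alpha> * mono_eval \<alpha> x)"
  using assms by (intro poly_eval_superset finite_multis) (auto simp: deg_le_def multis_def)

lemma poly_eval_add: "poly_eval (p + q) x = poly_eval p x + poly_eval q x"
proof -
  let ?K = "Poly_Mapping.keys p \<union> Poly_Mapping.keys q"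
  have "poly_eval r x = (\<Sum>\<alpha>\<in>?K. Poly_Mapping.lookup r \<alpha> * mono_eval \<alpha> x)" if "r \<in> {p, q, p + q}" for r
    using that keys_add[of p q] by (intro poly_eval_superset) auto
  then show ?thesis
    by (simp add: lookup_add algebra_simps sum.distrib)
qed

lemma poly_eval_0 [simp]: "poly_eval 0 x = 0"
  by (simp add: poly_eval_def)

lemma poly_eval_sum: "poly_eval (sum f A) x = (\<Sum>a\<in>A. poly_eval (f a) x)"
  by (induction A rule: infinite_finite_induct) (auto simp: poly_eval_add)

lemma poly_eval_single [simp]: "poly_eval (Poly_Mapping.single k c) x = c * mono_eval k x"
  by (simp add: poly_eval_def)

lemma poly_eval_scalem: "poly_eval (scalem c p) x = c * poly_eval p x"
proof -
  have "poly_eval (scalem c p) x =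
      (\<Sum>\<alpha>\<in>Poly_Mapping.keys p. Poly_Mapping.lookup (scalem c p) \<alpha> * mono_eval \<alpha> x)"
    by (intro poly_eval_superset) (auto simp: in_keys_iff lookup_scalem)
  then show ?thesis
    by (simp add: lookup_scalem poly_eval_def sum_distrib_left mult_ac)
qed

lemma poly_eval_mult: "poly_eval (p * q) x = poly_eval p x * poly_eval q x"
proof -
  have "poly_eval (p * q) x = poly_eval ((\<Sum>k\<in>Poly_Mapping.keys p. Poly_Mapping.single k (Poly_Mapping.lookup p k))
      * (\<Sum>k\<in>Poly_Mapping.keys q. Poly_Mapping.single k (Poly_Mapping.lookup q k))) x"
    using mpoly_eq_sum[of p] mpoly_eq_sum[of q] by simp
  also have "\<dots> = poly_eval p x * poly_eval q x"
    by (simp add: sum_product poly_eval_sum mult_single mono_eval_add)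
       (simp add: poly_eval_def sum_product mult_ac)
  finally show ?thesis .
qed

lemma deg_le_add: "deg_le p d \<Longrightarrow> deg_le q d \<Longrightarrow> deg_le (p + q) d"
  using keys_add[of p q] by (auto simp: deg_le_def)

lemma deg_le_scalem: "deg_le p d \<Longrightarrow> deg_le (scalem c p) d"
  by (auto simp: deg_le_def in_keys_iff lookup_scalem)

lemma deg_le_sum: "(\<And>a. a \<in> A \<Longrightarrow> deg_le (f a) d) \<Longrightarrow> deg_le (sum f A) d"
proof (induction A rule: infinite_finite_induct)
  case (insert x F)
  then show ?case by (simp add: deg_le_add)
qed (auto simp: deg_le_def)

lemma deg_le_single: "mdeg k \<le> d \<Longrightarrow> deg_le (Poly_Mapping.single k c) d"
  by (auto simp: deg_le_def)

lemma deg_le_mono: "deg_le p d \<Longrightarrow> d \<le> e \<Longrightarrow> deg_le p e"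
  by (auto simp: deg_le_def)

lemma deg_le_mult: "deg_le p d \<Longrightarrow> deg_le q e \<Longrightarrow> deg_le (p * q) (d + e)"
  using keys_mult[of p q] by (fastforce simp: deg_le_def mdeg_add)

lemma ex_deg_le: "\<exists>d. deg_le p d"
  unfolding deg_le_def by (rule exI[of _ "\<Sum>\<beta>\<in>Poly_Mapping.keys p. mdeg \<beta>"]) (auto intro: member_le_sum)

section \<open>Partial derivatives and Taylor expansion\<close>

lemma lookup_pderivm:
  "Poly_Mapping.lookup (pderivm \<alpha> p) \<gamma> =
     Poly_Mapping.lookup p (\<lambda>i. \<gamma> i + \<alpha> i) * (\<Prod>i\<in>UNIV. fact (\<gamma> i + \<alpha> i) / fact (\<gamma> i))"
proof -
  \<comment> \<open>Shifting exponents is injective, so the function under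
    \<open>Abs_poly_mapping\<close> inherits finite support from p; without that its lookup could
    not be computed.\<close>
  have "inj (\<lambda>\<gamma> i. \<gamma> i + \<alpha> i)"
    by (auto simp: inj_def fun_eq_iff)
  then have "finite ((\<lambda>\<gamma> i. \<gamma> i + \<alpha> i) -` {k. Poly_Mapping.lookup p k \<noteq> 0})"
    by (intro finite_vimageI) auto
  then have "finite {\<gamma>. Poly_Mapping.lookup p (\<lambda>i. \<gamma> i + \<alpha> i) *
      (\<Prod>i\<in>UNIV. fact (\<gamma> i + \<alpha> i) / fact (\<gamma> i)) \<noteq> 0}"
    by (rule rev_finite_subset) auto
  then show ?thesis
    unfolding pderivm_def by simp
qed

lemma pderivm_add: "pderivm \<alpha> (p + q) = pderivm \<alpha> p + pderivm \<alpha> q"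
  by (rule poly_mapping_eqI) (simp add: lookup_pderivm lookup_add algebra_simps)

lemma pderivm_scalem: "pderivm \<alpha> (scalem c p) = scalem c (pderivm \<alpha> p)"
  by (rule poly_mapping_eqI) (simp add: lookup_pderivm lookup_scalem algebra_simps)

lemma deg_le_pderivm: "deg_le p d \<Longrightarrow> deg_le (pderivm \<alpha> p) (d - mdeg \<alpha>)"
  unfolding deg_le_def
proof (rule ballI)
  fix \<beta> assume *: "\<forall>\<beta>\<in>Poly_Mapping.keys p. mdeg \<beta> \<le> d" and "\<beta> \<in> Poly_Mapping.keys (pderivm \<alpha> p)"
  then have "\<beta> + \<alpha> \<in> Poly_Mapping.keys p"
    by (auto simp: in_keys_iff lookup_pderivm plus_fun_def)
  with * have "mdeg (\<beta> + \<alpha>) \<le> d" by blast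
  then show "mdeg \<beta> \<le> d - mdeg \<alpha>" by (simp add: mdeg_add)
qed

lemma pderivm_eq_0:
  assumes "deg_le p d" "d < mdeg \<alpha>"
  shows "pderivm \<alpha> p = 0"
proof (rule poly_mapping_eqI)
  fix \<gamma>
  have "\<gamma> + \<alpha> \<notin> Poly_Mapping.keys p"
    using assms by (auto simp: deg_le_def mdeg_add dest!: bspec[of _ _ "\<gamma> + \<alpha>"])
  then show "Poly_Mapping.lookup (pderivm \<alpha> p) \<gamma> = Poly_Mapping.lookup 0 \<gamma>"
    by (simp add: in_keys_iff lookup_pderivm plus_fun_def)
qed

lemma taylor_add: "taylor (p + q) y \<alpha> = taylor p y \<alpha> + taylor q y \<alpha>"
  by (simp add: taylor_def pderivm_add poly_eval_add add_divide_distrib)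

lemma taylor_scalem: "taylor (scalem c p) y \<alpha> = c * taylor p y \<alpha>"
  by (simp add: taylor_def pderivm_scalem poly_eval_scalem)

lemma taylor_0 [simp]: "taylor 0 y \<alpha> = 0"
  using taylor_scalem[of 0 0] by (simp add: taylor_def pderivm_def)

lemma taylor_sum: "taylor (sum f A) y \<alpha> = (\<Sum>a\<in>A. taylor (f a) y \<alpha>)"
  by (induction A rule: infinite_finite_induct) (auto simp: taylor_add)

text \<open>The factorials of the derivative and of \<open>mfact\<close> combine to binomial
  coefficients. Truncated subtraction does no harm: if \<alpha> exceeds \<gamma> in some coordinate,
  the derivative and one binomial coefficient both vanish.\<close>

lemma taylor_single:
  "taylor (Poly_Mapping.single \<gamma> c) y \<alpha> =
    c * (\<Prod>i\<in>UNIV. real (\<gamma> i choose \<alpha> i) * (y $ i) ^ (\<gamma> i - \<alpha> i))"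
proof (cases "\<forall>i. \<alpha> i \<le> \<gamma> i")
  case True
  have "pderivm \<alpha> (Poly_Mapping.single \<gamma> c) =
      Poly_Mapping.single (\<lambda>i. \<gamma> i - \<alpha> i) (c * (\<Prod>i\<in>UNIV. fact (\<gamma> i) / fact (\<gamma> i - \<alpha> i)))"
  proof (rule poly_mapping_eqI)
    fix k
    have "\<gamma> = (\<lambda>i. k i + \<alpha> i) \<longleftrightarrow> (\<lambda>i. \<gamma> i - \<alpha> i) = k"
      using True by (auto simp: fun_eq_iff) (metis add_diff_cancel_right' le_add_diff_inverse2)+
    then show "Poly_Mapping.lookup (pderivm \<alpha> (Poly_Mapping.single \<gamma> c)) k =
      Poly_Mapping.lookup (Poly_Mapping.single (\<lambda>i. \<gamma> i - \<alpha> i) (c * (\<Prod>i\<in>UNIV. fact (\<gamma> i) / fact (\<gamma> i - \<alpha> i)))) k"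
      using True by (auto simp: lookup_pderivm lookup_single when_def)
  qed
  then have "taylor (Poly_Mapping.single \<gamma> c) y \<alpha> =
      c * (\<Prod>i\<in>UNIV. fact (\<gamma> i) / fact (\<gamma> i - \<alpha> i) * (y $ i) ^ (\<gamma> i - \<alpha> i) / fact (\<alpha> i))"
    by (simp add: taylor_def mono_eval_def mfact_def prod.distrib prod_dividef)
  also have "\<dots> = c * (\<Prod>i\<in>UNIV. real (\<gamma> i choose \<alpha> i) * (y $ i) ^ (\<gamma> i - \<alpha> i))"
    using True by (intro arg_cong2[where f="(*)"] prod.cong refl) (simp add: binomial_fact)
  finally show ?thesis .
next
  case False
  then obtain j where j: "\<gamma> j < \<alpha> j" by (auto simp: not_le)
  have "pderivm \<alpha> (Poly_Mapping.single \<gamma> c) = 0"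
  proof (rule poly_mapping_eqI)
    fix k
    have "\<gamma> \<noteq> (\<lambda>i. k i + \<alpha> i)" using j by (metis not_add_less2)
    then show "Poly_Mapping.lookup (pderivm \<alpha> (Poly_Mapping.single \<gamma> c)) k = Poly_Mapping.lookup 0 k"
      by (simp add: lookup_pderivm lookup_single)
  qed
  moreover have "(\<Prod>i\<in>UNIV. real (\<gamma> i choose \<alpha> i) * (y $ i) ^ (\<gamma> i - \<alpha> i)) = 0"
    using j by (intro prod_zero) (auto intro!: bexI[of _ j])
  ultimately show ?thesis by (simp add: taylor_def)
qed

lemma prod_sum_below:
  fixes f :: "'n::finite \<Rightarrow> nat \<Rightarrow> real"
  shows "(\<Prod>i\<in>UNIV. \<Sum>k\<le>\<gamma> i. f i k) = (\<Sum>\<alpha> | \<forall>i. \<alpha> i \<le> \<gamma> i. \<Prod>i\<in>UNIV. f i (\<alpha> i))"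
proof -
  have "{\<alpha>. \<forall>i. \<alpha> i \<le> \<gamma> i} = PiE UNIV (\<lambda>i. {..\<gamma> i})"
    by (simp add: PiE_UNIV_domain Pi_def)
  then show ?thesis
    by (simp only: prod_sum_PiE[OF finite finite_atMost])
qed

text \<open>The binomial theorem in each coordinate. Summing over \<open>multis d\<close> instead of
  the multi-indices below \<gamma> only adds zeros, and gives all monomials of one polynomial a
  common index set.\<close>

lemma taylor_expansion_single:
  assumes "mdeg \<gamma> \<le> d"
  shows "c * mono_eval \<gamma> (y + z) = (\<Sum>\<alpha>\<in>multis d. taylor (Poly_Mapping.single \<gamma> c) y \<alpha> * mono_eval \<alpha> z)"
proof -
  have "mono_eval \<gamma> (y + z) = (\<Prod>i\<in>UNIV. \<Sum>k\<le>\<gamma> i. real (\<gamma> i choose k) * (y $ i) ^ (\<gamma> i - k) * (z $ i) ^ k)"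
    unfolding mono_eval_def
    by (intro prod.cong refl) (simp add: add.commute[of "y $ _"] binomial_ring mult_ac)
  also have "\<dots> = (\<Sum>\<alpha> | \<forall>i. \<alpha> i \<le> \<gamma> i. \<Prod>i\<in>UNIV. real (\<gamma> i choose \<alpha> i) * (y $ i) ^ (\<gamma> i - \<alpha> i) * (z $ i) ^ \<alpha> i)"
    by (rule prod_sum_below)
  finally have "c * mono_eval \<gamma> (y + z) =
      (\<Sum>\<alpha> | \<forall>i. \<alpha> i \<le> \<gamma> i. taylor (Poly_Mapping.single \<gamma> c) y \<alpha> * mono_eval \<alpha> z)"
    by (simp add: taylor_single mono_eval_def prod.distrib sum_distrib_left mult_ac)
  also have "\<dots> = (\<Sum>\<alpha>\<in>multis d. taylor (Poly_Mapping.single \<gamma> c) y \<alpha> * mono_eval \<alpha> z)"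
  proof (rule sum.mono_neutral_left)
    show "{\<alpha>. \<forall>i. \<alpha> i \<le> \<gamma> i} \<subseteq> multis d"
      using assms by (auto simp: multis_def mdeg_def intro: order_trans[OF sum_mono])
    show "\<forall>\<alpha>\<in>multis d - {\<alpha>. \<forall>i. \<alpha> i \<le> \<gamma> i}. taylor (Poly_Mapping.single \<gamma> c) y \<alpha> * mono_eval \<alpha> z = 0"
      by (auto simp: taylor_single not_le intro!: exI)
  qed simp
  finally show ?thesis .
qed

lemma taylor_expansion:
  assumes "deg_le q d"
  shows "poly_eval q (y + z) = (\<Sum>\<alpha>\<in>multis d. taylor q y \<alpha> * mono_eval \<alpha> z)"
proof -
  have "poly_eval q (y + z) = (\<Sum>\<gamma>\<in>Poly_Mapping.keys q. \<Sum>\<alpha>\<in>multis d.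
      taylor (Poly_Mapping.single \<gamma> (Poly_Mapping.lookup q \<gamma>)) y \<alpha> * mono_eval \<alpha> z)"
    unfolding poly_eval_def using assms
    by (intro sum.cong refl taylor_expansion_single) (auto simp: deg_le_def)
  also have "\<dots> = (\<Sum>\<alpha>\<in>multis d.
      taylor (\<Sum>\<gamma>\<in>Poly_Mapping.keys q. Poly_Mapping.single \<gamma> (Poly_Mapping.lookup q \<gamma>)) y \<alpha> * mono_eval \<alpha> z)"
    by (subst sum.swap) (simp add: taylor_sum sum_distrib_right)
  finally show ?thesis
    using mpoly_eq_sum[of q] by simp
qed

section \<open>The operator A on polynomials of bounded degree\<close>

lemma opA_eq_sum:
  assumes "deg_le p d"
  shows "opA a p = (\<Sum>\<alpha>\<in>multis d. scalem (1 / mfact \<alpha>) (a \<alpha> * pderivm \<alpha> p))"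
proof -
  have "(\<lambda>\<alpha>. Poly_Mapping.map (\<lambda>c. c / mfact \<alpha>) (a \<alpha> * pderivm \<alpha> p)) =
        (\<lambda>\<alpha>. scalem (1 / mfact \<alpha>) (a \<alpha> * pderivm \<alpha> p))"
    by (intro ext arg_cong2[where f=Poly_Mapping.map]) simp_all
  \<comment> \<open>Derivatives of order above d vanish, which turns the formal sum into a finite
    one over a set that depends on d alone.\<close>
  moreover have "scalem (1 / mfact \<alpha>) (a \<alpha> * pderivm \<alpha> p) = 0" if "\<alpha> \<notin> multis d" for \<alpha>
    using that pderivm_eq_0[OF assms, of \<alpha>]
    by (simp add: multis_def map_eq_zero_iff)
  ultimately show ?thesis
    unfolding opA_def by (simp only:) (intro Sum_any.expand_superset, auto)
qed

lemma poly_eval_opA: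
  assumes "deg_le p d"
  shows "poly_eval (opA a p) y = (\<Sum>\<alpha>\<in>multis d. poly_eval (a \<alpha>) y * taylor p y \<alpha>)"
  by (simp add: opA_eq_sum[OF assms] poly_eval_sum poly_eval_scalem poly_eval_mult taylor_def)

text \<open>Differentiation loses the \<open>mdeg \<alpha>\<close> degrees that the factor
  \<open>a \<alpha>\<close> may add. This invariance reduces the exponential to finite-dimensional
  spaces.\<close>

lemma deg_le_opA:
  assumes "\<forall>\<alpha>. deg_le (a \<alpha>) (mdeg \<alpha>)" "deg_le p d"
  shows "deg_le (opA a p) d"
  unfolding opA_eq_sum[OF assms(2)]
proof (intro deg_le_sum deg_le_scalem)
  fix \<alpha> :: "'a \<Rightarrow> nat" assume "\<alpha> \<in> multis d"
  then show "deg_le (a \<alpha> * pderivm \<alpha> p) d"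
    using deg_le_mult[OF assms(1)[rule_format, of \<alpha>] deg_le_pderivm[OF assms(2), of \<alpha>]]
    by (simp add: multis_def)
qed

lemma opA_add: "opA a (p + q) = opA a p + opA a q"
proof -
  obtain d e where "deg_le p d" "deg_le q e" using ex_deg_le by blast
  then have d: "deg_le p (max d e)" "deg_le q (max d e)" by (auto elim: deg_le_mono)
  show ?thesis
    unfolding opA_eq_sum[OF d(1)] opA_eq_sum[OF d(2)] opA_eq_sum[OF deg_le_add[OF d]]
    by (simp add: pderivm_add sum.distrib[symmetric] ring_distribs)
       (intro sum.cong refl poly_mapping_eqI, simp add: lookup_scalem lookup_add algebra_simps add_divide_distrib)
qed

lemma mult_scalem: "p * scalem c q = scalem c (p * q)"
  by (simp add: mult_map_scale_conv_mult mult_ac)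

lemma opA_scalem: "opA a (scalem c p) = scalem c (opA a p)"
proof -
  obtain d where d: "deg_le p d" using ex_deg_le by blast
  show ?thesis
    unfolding opA_eq_sum[OF d] opA_eq_sum[OF deg_le_scalem[OF d]]
    by (rule poly_mapping_eqI)
       (simp add: pderivm_scalem mult_scalem lookup_scalem lookup_sum sum_distrib_left)
qed

lemma opA_0 [simp]: "opA a 0 = 0"
  using opA_add[of a 0 0] by simp

lemma opA_sum: "opA a (sum f A) = (\<Sum>x\<in>A. opA a (f x))"
  by (induction A rule: infinite_finite_induct) (auto simp: opA_add)

section \<open>From the Levy triple to the positive minimum principle\<close>

lemma sum_squares_decomposition:
  fixes S :: "'n::finite \<Rightarrow> 'n \<Rightarrow> real"
  assumes "finite I" "\<And>i j. S i j = S j i"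
    and "\<And>x. 0 \<le> (\<Sum>i\<in>UNIV. \<Sum>j\<in>UNIV. x i * x j * S i j)"
    and "\<And>i j. i \<notin> I \<Longrightarrow> S i j = 0"
  shows "\<exists>v. \<forall>i j. S i j = (\<Sum>k\<in>I. v k i * v k j)"
  using assms
\<comment> \<open>Cholesky elimination; I contains all rows that may be non-zero. A vanishing pivot
  forces its whole row to vanish, and a positive one allows passing to the Schur complement, whose
  row k is zero.\<close>
proof (induction I arbitrary: S rule: finite_induct)
  case empty
  then show ?case by auto
next
  case (insert k I)
  define Q where "Q x = (\<Sum>i\<in>UNIV. \<Sum>j\<in>UNIV. x i * x j * S i j)" for x
  have Q_pos: "Q x \<ge> 0" for x unfolding Q_def by (rule insert.prems(2))
  have delta: "(\<Sum>i\<in>UNIV. (if i = k then b else 0) * f i) = b * f k" for b :: real and f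
  proof -
    have "(\<Sum>i\<in>UNIV. (if i = k then b else 0) * f i) = (\<Sum>i\<in>UNIV. if i = k then b * f i else 0)"
      by (intro sum.cong) auto
    then show ?thesis by (simp add: sum.delta)
  qed
  have Q_shift: "Q (\<lambda>i. x i + (if i = k then t else 0)) = Q x + 2 * t * (\<Sum>i\<in>UNIV. S k i * x i) + t\<^sup>2 * S k k" for x t
  proof -
    define e where "e i = (if i = k then t else 0)" for i
    have "Q (\<lambda>i. x i + e i) = Q x + (\<Sum>i\<in>UNIV. \<Sum>j\<in>UNIV. x i * e j * S i j)
        + (\<Sum>i\<in>UNIV. \<Sum>j\<in>UNIV. e i * x j * S i j) + (\<Sum>i\<in>UNIV. \<Sum>j\<in>UNIV. e i * e j * S i j)"
      by (simp add: Q_def algebra_simps sum.distrib)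
    moreover have "(\<Sum>i\<in>UNIV. \<Sum>j\<in>UNIV. x i * e j * S i j) = t * (\<Sum>i\<in>UNIV. S k i * x i)"
    proof -
      have "(\<Sum>j\<in>UNIV. x i * e j * S i j) = t * (S k i * x i)" for i
        using delta[of t "\<lambda>j. x i * S i j"] insert.prems(1)[of i k] by (simp add: e_def mult_ac)
      then show ?thesis by (simp add: sum_distrib_left)
    qed
    moreover have "(\<Sum>i\<in>UNIV. \<Sum>j\<in>UNIV. e i * f j * S i j) = t * (\<Sum>j\<in>UNIV. S k j * f j)" for f
    proof -
      have "(\<Sum>i\<in>UNIV. \<Sum>j\<in>UNIV. e i * f j * S i j) = (\<Sum>i\<in>UNIV. e i * (\<Sum>j\<in>UNIV. S i j * f j))"
        by (simp add: sum_distrib_left mult_ac)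
      then show ?thesis by (simp only: e_def delta)
    qed
    moreover have "(\<Sum>j\<in>UNIV. S k j * e j) = t * S k k"
      using delta[of t "S k"] by (simp add: e_def mult_ac)
    ultimately show ?thesis by (simp add: e_def power2_eq_square)
  qed
  show ?case
  proof (cases "S k k = 0")
    case True
    have S_k: "S k j = 0" for j
    proof (rule ccontr)
      assume ne: "S k j \<noteq> 0"
      let ?e = "\<lambda>i. if i = j then 1 else (0::real)"
      have "(\<Sum>i\<in>UNIV. S k i * ?e i) = S k j"
        by (simp add: if_distrib[of "\<lambda>x. _ * x"] sum.delta cong: if_cong)
      then have "Q ?e + 2 * t * S k j \<ge> 0" for t
        using Q_pos[of "\<lambda>i. ?e i + (if i = k then t else 0)"] Q_shift[of ?e t] True by simp
      \<comment> \<open>For a vanishing pivot Q is affine along coordinate k; at this parameter it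
        would equal -1.\<close>
      from this[of "- (Q ?e + 1) / (2 * S k j)"] ne show False by (simp add: field_simps)
    qed
    have "S i j = 0" if "i \<notin> I" for i j
      using that S_k insert.prems(3) by (cases "i = k") auto
    then obtain v where v: "\<forall>i j. S i j = (\<Sum>k\<in>I. v k i * v k j)"
      using insert.IH[OF insert.prems(1,2)] by blast
    have "(\<Sum>l\<in>insert k I. (v(k := \<lambda>_. 0)) l i * (v(k := \<lambda>_. 0)) l j) = (\<Sum>l\<in>I. v l i * v l j)" for i j
      using insert.hyps by (auto intro!: sum.cong)
    then show ?thesis
      using v by (intro exI[of _ "v(k := \<lambda>_. 0)"]) simp
  next
    case False
    have "Q (\<lambda>i. if i = k then 1 else 0) = S k k"
      using Q_shift[of "\<lambda>_. 0" 1] by (simp add: Q_def)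
    with Q_pos False have pos: "S k k > 0" by (metis less_eq_real_def)
    define S' where "S' i j = S i j - S k i * S k j / S k k" for i j
    have "0 \<le> (\<Sum>i\<in>UNIV. \<Sum>j\<in>UNIV. x i * x j * S' i j)" for x
    proof -
      define r where "r = (\<Sum>i\<in>UNIV. S k i * x i)"
      have "r * r = (\<Sum>i\<in>UNIV. \<Sum>j\<in>UNIV. x i * x j * (S k i * S k j))"
        by (simp add: r_def sum_product mult_ac)
      then have "(\<Sum>i\<in>UNIV. \<Sum>j\<in>UNIV. x i * x j * S' i j) = Q x - r * r / S k k"
        by (simp add: S'_def Q_def right_diff_distrib sum_subtractf sum_divide_distrib)
      \<comment> \<open>The form of the Schur complement at x is the minimum of Q over all shifts of
        coordinate k, attained at the shift \<open>- r / S k k\<close>.\<close>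
      also have "\<dots> = Q (\<lambda>i. x i + (if i = k then - r / S k k else 0))"
        using pos unfolding Q_shift r_def[symmetric] by (simp add: field_simps power2_eq_square)
      finally show ?thesis using Q_pos by simp
    qed
    moreover have "S' i j = 0" if "i \<notin> I" for i j
      using that pos insert.prems(3)[of i] insert.prems(1)[of k i] by (cases "i = k") (auto simp: S'_def)
    moreover have "S' i j = S' j i" for i j
      using insert.prems(1)[of i j] by (simp add: S'_def mult_ac)
    ultimately obtain v where v: "\<forall>i j. S' i j = (\<Sum>k\<in>I. v k i * v k j)"
      using insert.IH[of S'] by blast
    define v' where "v' = v(k := \<lambda>i. S k i / sqrt (S k k))"
    have "S i j = (\<Sum>l\<in>insert k I. v' l i * v' l j)" for i j
    proof -
      have "(\<Sum>l\<in>I. v' l i * v' l j) = S' i j"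
        using insert.hyps v by (auto simp: v'_def intro!: sum.cong)
      moreover have "v' k i * v' k j = S k i * S k j / S k k"
        using pos by (simp add: v'_def)
      ultimately show ?thesis
        using insert.hyps by (simp add: S'_def)
    qed
    then show ?thesis by blast
  qed
qed

text \<open>With this, pairing \<Sigma> with the quadratic part of a polynomial amounts to adding
  values of that part at the vectors v k, so that only its sign on vectors matters.\<close>

lemma psd_sum_outer_products:
  fixes S :: "real^'n^'n"
  assumes "psd S"
  obtains v :: "'n \<Rightarrow> real^'n" where "\<And>i j. S $ i $ j = (\<Sum>k\<in>UNIV. v k $ i * v k $ j)"
proof -
  have sym: "S $ i $ j = S $ j $ i" for i j
  proof -
    have "transpose S $ j $ i = S $ j $ i" using assms by (simp add: psd_def)
    then show ?thesis by (simp add: transpose_def)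
  qed
  have nonneg: "0 \<le> (\<Sum>i\<in>UNIV. \<Sum>j\<in>UNIV. x i * x j * S $ i $ j)" for x
  proof -
    have "0 \<le> vec_lambda x \<bullet> (S *v vec_lambda x)" using assms by (simp add: psd_def)
    then show ?thesis
      by (simp add: inner_vec_def matrix_vector_mult_def sum_distrib_left mult_ac)
  qed
  obtain v where "\<forall>i j. S $ i $ j = (\<Sum>k\<in>(UNIV::'n set). v k i * v k j)"
  proof -
    have "\<exists>v. \<forall>i j. S $ i $ j = (\<Sum>k\<in>(UNIV::'n set). v k i * v k j)"
      by (rule sum_squares_decomposition[of UNIV "\<lambda>i j. S $ i $ j", OF finite sym nonneg]) simp
    then show ?thesis using that by blast
  qed
  then show ?thesis by (intro that[of "\<lambda>k. vec_lambda (v k)"]) simp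
qed

section \<open>Second-order behaviour at a zero of a non-negative polynomial\<close>

lemma nonneg_poly_low_coeffs:
  fixes c :: "nat \<Rightarrow> real"
  assumes "\<And>s. 0 \<le> (\<Sum>k\<le>d. c k * s ^ k)" "c 0 = 0" "2 \<le> d"
  shows "c 1 = 0" "0 \<le> c 2"
proof -
  obtain e where e: "d = Suc (Suc e)"
    using assms(3) by (metis Suc_le_D numeral_2_eq_2 Suc_le_mono)
  \<comment> \<open>The quotient by s is non-negative to the right of 0 and non-positive to the
    left, so its value c 1 at 0 vanishes. After a second division by s, c 2 is a right limit of
    non-negative values.\<close>
  define h where "h s = (\<Sum>k\<le>Suc e. c (Suc k) * s ^ k)" for s
  have sh: "0 \<le> s * h s" for s
    using assms(1)[of s] unfolding e h_def
    by (subst (asm) sum.atMost_Suc_shift) (simp add: assms(2) sum_distrib_left mult_ac del: sum.atMost_Suc)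
  have "isCont h 0" unfolding h_def by (intro continuous_intros)
  then have h: "(h \<longlongrightarrow> c 1) (at_right 0)" "(h \<longlongrightarrow> c 1) (at_left 0)"
    by (simp_all add: isCont_def filterlim_at_split h_def sum.atMost_Suc_shift del: sum.atMost_Suc)
  have "0 \<le> h s" if "s > 0" for s
    using sh[of s] that by (simp add: zero_le_mult_iff)
  then have "c 1 \<ge> 0"
    by (intro tendsto_lowerbound[OF h(1)]) (auto simp: eventually_at_right_field intro!: exI[of _ 1])
  moreover have "h s \<le> 0" if "s < 0" for s
    using sh[of s] that by (simp add: zero_le_mult_iff)
  then have "c 1 \<le> 0"
    by (intro tendsto_upperbound[OF h(2)]) (auto simp: eventually_at_left_field intro!: exI[of _ "-1"])
  ultimately show c1: "c 1 = 0" by simp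
  define g where "g s = (\<Sum>k\<le>e. c (Suc (Suc k)) * s ^ k)" for s
  have "h s = s * g s" for s
    using c1 unfolding h_def g_def
    by (subst sum.atMost_Suc_shift) (simp add: sum_distrib_left mult_ac)
  then have g_pos: "0 \<le> g s" if "s > 0" for s
    using sh[of s] that by (simp add: zero_le_mult_iff)
  have "isCont g 0" unfolding g_def by (intro continuous_intros)
  moreover have "g 0 = c 2"
    by (cases e) (simp_all add: g_def sum.atMost_Suc_shift numeral_2_eq_2 del: sum.atMost_Suc)
  ultimately have "(g \<longlongrightarrow> c 2) (at_right 0)"
    by (simp add: isCont_def filterlim_at_split)
  then show "0 \<le> c 2"
    by (rule tendsto_lowerbound) (auto simp: eventually_at_right_field g_pos intro!: exI[of _ 1])
qed

lemma mdeg_0: "mdeg \<alpha> = 0 \<longleftrightarrow> \<alpha> = 0"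
  by (auto simp: mdeg_def)

lemma mdeg_unitv [simp]: "mdeg (unitv i) = 1"
  by (simp add: mdeg_def unitv_def)

lemma mdeg_Suc:
  assumes "mdeg \<alpha> = Suc n"
  obtains \<beta> i where "\<alpha> = \<beta> + unitv i" "mdeg \<beta> = n"
proof -
  obtain i where i: "\<alpha> i > 0"
  proof -
    have "\<not> (\<forall>i. \<alpha> i = 0)"
    proof
      assume "\<forall>i. \<alpha> i = 0"
      with assms show False by (simp add: mdeg_def)
    qed
    then show ?thesis using that by auto
  qed
  define \<beta> where "\<beta> = \<alpha>(i := \<alpha> i - 1)"
  have "\<alpha> = \<beta> + unitv i" using i by (auto simp: \<beta>_def unitv_def fun_eq_iff)
  moreover from this have "mdeg \<beta> = n" using assms by (simp add: mdeg_add)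
  ultimately show ?thesis by (rule that)
qed

lemma mdeg_1:
  assumes "mdeg \<alpha> = 1"
  shows "\<exists>i. \<alpha> = unitv i"
proof -
  obtain \<beta> i where "\<alpha> = \<beta> + unitv i" "mdeg \<beta> = 0"
    using mdeg_Suc[of \<alpha> 0] assms by auto
  then show ?thesis by (auto simp: mdeg_0)
qed

lemma mdeg_2:
  assumes "mdeg \<alpha> = 2"
  shows "\<exists>i j. \<alpha> = unitv i + unitv j"
proof -
  obtain \<beta> i where "\<alpha> = \<beta> + unitv i" "mdeg \<beta> = 1"
    using mdeg_Suc[of \<alpha> 1] assms by auto
  then show ?thesis using mdeg_1 by blast
qed

lemma mono_eval_unitv [simp]: "mono_eval (unitv i) x = x $ i"
  by (simp add: mono_eval_def unitv_def if_distrib[of "\<lambda>k. _ ^ k"] prod.delta cong: if_cong)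

lemma mono_eval_0 [simp]: "mono_eval 0 x = 1"
  by (simp add: mono_eval_def)

lemma mono_eval_scaleR: "mono_eval \<alpha> (s *\<^sub>R x) = s ^ mdeg \<alpha> * mono_eval \<alpha> x"
  by (simp add: mono_eval_def mdeg_def power_mult_distrib prod.distrib power_sum)

lemma borel_measurable_mono_eval [measurable]: "mono_eval \<alpha> \<in> borel_measurable borel"
  unfolding mono_eval_def by (intro borel_measurable_continuous_onI continuous_intros)

definition hom_part :: "'n::finite mpoly \<Rightarrow> real^'n \<Rightarrow> nat \<Rightarrow> real^'n \<Rightarrow> real" where
  "hom_part q y k z = (\<Sum>\<alpha> | mdeg \<alpha> = k. taylor q y \<alpha> * mono_eval \<alpha> z)"

lemma poly_eval_hom_parts:
  assumes "deg_le q d"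
  shows "poly_eval q (y + s *\<^sub>R z) = (\<Sum>k\<le>d. hom_part q y k z * s ^ k)"
proof -
  have "poly_eval q (y + s *\<^sub>R z) = (\<Sum>\<alpha>\<in>multis d. taylor q y \<alpha> * mono_eval \<alpha> z * s ^ mdeg \<alpha>)"
    by (simp add: taylor_expansion[OF assms] mono_eval_scaleR mult_ac)
  also have "\<dots> = (\<Sum>k\<le>d. \<Sum>\<alpha> | \<alpha> \<in> multis d \<and> mdeg \<alpha> = k. taylor q y \<alpha> * mono_eval \<alpha> z * s ^ mdeg \<alpha>)"
    by (intro sum.group[symmetric] finite_multis) (auto simp: multis_def)
  also have "\<dots> = (\<Sum>k\<le>d. hom_part q y k z * s ^ k)"
    unfolding hom_part_def sum_distrib_right
    by (intro sum.cong refl) (auto simp: multis_def)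
  finally show ?thesis .
qed

text \<open>On each line through y the polynomial restricts to a non-negative polynomial in one
  variable with a zero at parameter 0, to which \<open>nonneg_poly_low_coeffs\<close>
  applies.\<close>

lemma Pos_zero_taylor:
  assumes "q \<in> Pos" "poly_eval q y = 0"
  shows "mdeg \<alpha> < 2 \<Longrightarrow> taylor q y \<alpha> = 0" and "0 \<le> hom_part q y 2 z"
proof -
  obtain d where "deg_le q d" using ex_deg_le by blast
  \<comment> \<open>Padding the degree ensures that a coefficient of index 2 occurs in the
    sum.\<close>
  then have d: "deg_le q (d + 2)" by (rule deg_le_mono) simp
  have 0: "hom_part q y 0 z = 0" for z
    using poly_eval_hom_parts[OF d, of y 0 z] assms(2)
    by (simp add: power_0_left if_distrib[of "\<lambda>x. _ * x"] cong: if_cong)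
  have nonneg: "0 \<le> (\<Sum>k\<le>d + 2. hom_part q y k z * s ^ k)" for s z
    unfolding poly_eval_hom_parts[OF d, symmetric] using assms(1) by (simp add: Pos_def)
  show "0 \<le> hom_part q y 2 z"
    by (rule nonneg_poly_low_coeffs(2)[OF nonneg 0]) simp
  have 1: "hom_part q y 1 z = 0" for z
    by (rule nonneg_poly_low_coeffs(1)[OF nonneg 0]) simp
  assume "mdeg \<alpha> < 2"
  then consider "\<alpha> = 0" | i where "\<alpha> = unitv i"
    using mdeg_0[of \<alpha>] mdeg_1[of \<alpha>] by (auto simp: less_2_cases_iff)
  then show "taylor q y \<alpha> = 0"
  proof cases
    case 1
    then show ?thesis using 0[of 0] by (simp add: hom_part_def mdeg_0)
  next
    case 2
    \<comment> \<open>On the i-th axis all other monomials of degree one vanish, which isolates a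
      single first-order coefficient.\<close>
    have "hom_part q y 1 (axis i 1) = (\<Sum>\<alpha>\<in>{unitv i}. taylor q y \<alpha> * mono_eval \<alpha> (axis i 1))"
      unfolding hom_part_def
    proof (rule sum.mono_neutral_right)
      show "finite {\<alpha>::'a \<Rightarrow> nat. mdeg \<alpha> = 1}"
        by (rule finite_subset[OF _ finite_multis[of 1]]) (auto simp: multis_def)
      show "\<forall>\<alpha>\<in>{\<alpha>. mdeg \<alpha> = 1} - {unitv i}. taylor q y \<alpha> * mono_eval \<alpha> (axis i 1) = 0"
      proof
        fix \<beta> assume \<beta>: "\<beta> \<in> {\<alpha>. mdeg \<alpha> = 1} - {unitv i}"
        then obtain j where "\<beta> = unitv j" using mdeg_1[of \<beta>] by auto
        with \<beta> show "taylor q y \<beta> * mono_eval \<beta> (axis i 1) = 0"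
          by (auto simp: axis_def)
      qed
    qed simp
    then show ?thesis using 1[of "axis i 1"] 2 by (simp add: axis_def)
  qed
qed

lemma levy_imp_pos_min:
  fixes a :: "('n::finite \<Rightarrow> nat) \<Rightarrow> 'n mpoly" and y :: "real^'n"
  assumes S: "psd S" and [measurable_cong]: "sets \<nu> = sets borel"
    and int: "\<And>\<alpha>. 2 \<le> mdeg \<alpha> \<Longrightarrow> integrable \<nu> (\<lambda>x. \<bar>mono_eval \<alpha> x\<bar>)"
    and 2: "\<And>i j. poly_eval (a (unitv i + unitv j)) y = S $ i $ j + (LINT x|\<nu>. mono_eval (unitv i + unitv j) x)"
    and 3: "\<And>\<alpha>. 3 \<le> mdeg \<alpha> \<Longrightarrow> poly_eval (a \<alpha>) y = (LINT x|\<nu>. mono_eval \<alpha> x)"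
  shows "pos_min a y"
  unfolding pos_min_def
proof (intro ballI impI)
  fix q :: "'n mpoly" assume q: "q \<in> Pos" "poly_eval q y = 0"
  obtain d where "deg_le q d" using ex_deg_le by blast
  then have d: "deg_le q (d + 2)" by (rule deg_le_mono) simp
  define M where "M = {\<alpha> \<in> multis (d + 2) :: ('n \<Rightarrow> nat) set. 2 \<le> mdeg \<alpha>}"
  define m where "m \<alpha> = (LINT x|\<nu>. mono_eval \<alpha> x)" for \<alpha>
  obtain v :: "'n \<Rightarrow> real^'n" where v: "\<And>i j. S $ i $ j = (\<Sum>k\<in>UNIV. v k $ i * v k $ j)"
    using psd_sum_outer_products[OF S] by blast
  have int': "integrable \<nu> (mono_eval \<alpha>)" if "2 \<le> mdeg \<alpha>" for \<alpha>
    using int[OF that] by (subst (asm) integrable_abs_iff) auto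
  have low: "taylor q y \<alpha> = 0" if "\<alpha> \<in> multis (d + 2) - M" for \<alpha>
    using that Pos_zero_taylor(1)[OF q] by (auto simp: M_def)
  have sub: "M \<subseteq> multis (d + 2)" "finite M" by (auto simp: M_def)
  have "poly_eval (opA a q) y = (\<Sum>\<alpha>\<in>M. poly_eval (a \<alpha>) y * taylor q y \<alpha>)"
    unfolding poly_eval_opA[OF d] using low sub by (intro sum.mono_neutral_right) auto
  \<comment> \<open>Each coefficient is split into its moment and a remainder. The remainder
    vanishes from degree 3 on and is an entry of S in degree 2, where the outer products turn it
    into a sum of monomials at the v k.\<close>
  also have "\<dots> = (\<Sum>\<alpha>\<in>M. (poly_eval (a \<alpha>) y - m \<alpha>) * taylor q y \<alpha>) + (\<Sum>\<alpha>\<in>M. m \<alpha> * taylor q y \<alpha>)"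
    by (simp add: algebra_simps sum.distrib sum_subtractf)
  also have "(\<Sum>\<alpha>\<in>M. (poly_eval (a \<alpha>) y - m \<alpha>) * taylor q y \<alpha>) =
      (\<Sum>\<alpha> | mdeg \<alpha> = 2. (\<Sum>k\<in>UNIV. mono_eval \<alpha> (v k)) * taylor q y \<alpha>)"
  proof (rule sum.mono_neutral_cong_right)
    show "\<forall>\<alpha>\<in>M - {\<alpha>. mdeg \<alpha> = 2}. (poly_eval (a \<alpha>) y - m \<alpha>) * taylor q y \<alpha> = 0"
    proof
      fix \<alpha> assume "\<alpha> \<in> M - {\<alpha>. mdeg \<alpha> = 2}"
      then have "3 \<le> mdeg \<alpha>" by (auto simp: M_def)
      then show "(poly_eval (a \<alpha>) y - m \<alpha>) * taylor q y \<alpha> = 0" using 3 by (simp add: m_def)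
    qed
    show "(poly_eval (a \<alpha>) y - m \<alpha>) * taylor q y \<alpha> = (\<Sum>k\<in>UNIV. mono_eval \<alpha> (v k)) * taylor q y \<alpha>"
      if \<alpha>: "\<alpha> \<in> {\<alpha>. mdeg \<alpha> = 2}" for \<alpha>
    proof -
      obtain i j where "\<alpha> = unitv i + unitv j" using \<alpha> mdeg_2[of \<alpha>] by auto
      then show ?thesis using 2[of i j] v[of i j] by (simp add: m_def mono_eval_add)
    qed
  qed (use sub in \<open>auto simp: M_def multis_def\<close>)
  also have "\<dots> = (\<Sum>k\<in>UNIV. hom_part q y 2 (v k))"
    unfolding hom_part_def sum_distrib_right by (subst sum.swap) (simp add: mult_ac)
  also have "(\<Sum>\<alpha>\<in>M. m \<alpha> * taylor q y \<alpha>) = (LINT x|\<nu>. (\<Sum>\<alpha>\<in>M. mono_eval \<alpha> x * taylor q y \<alpha>))"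
    unfolding m_def
    by (subst Bochner_Integration.integral_sum) (auto simp: M_def intro!: integrable_mult_left int')
  \<comment> \<open>The coefficients of degree below two vanish, so the sum over M is already the
    full Taylor expansion.\<close>
  also have "\<dots> = (LINT x|\<nu>. poly_eval q (y + x))"
  proof (intro Bochner_Integration.integral_cong refl)
    fix x
    show "(\<Sum>\<alpha>\<in>M. mono_eval \<alpha> x * taylor q y \<alpha>) = poly_eval q (y + x)"
      unfolding taylor_expansion[OF d] using low sub
      by (intro sum.mono_neutral_cong_left) auto
  qed
  finally show "0 \<le> poly_eval (opA a q) y"
    using q(1) Pos_zero_taylor(2)[OF q]
    by (auto simp: Pos_def intro!: add_nonneg_nonneg sum_nonneg integral_nonneg_AE)
qed

section \<open>The semigroup and the positive minimum principle\<close>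

lemma mpoly_eq_sum_multis:
  assumes "deg_le p d"
  shows "p = (\<Sum>\<gamma>\<in>multis d. scalem (Poly_Mapping.lookup p \<gamma>) (Poly_Mapping.single \<gamma> 1))"
proof (rule poly_mapping_eqI)
  fix k
  have "(\<Sum>\<gamma>\<in>multis d. Poly_Mapping.lookup p \<gamma> when \<gamma> = k) = Poly_Mapping.lookup p k"
  proof (cases "k \<in> multis d")
    case True
    then show ?thesis by (simp add: when_def sum.delta)
  next
    case False
    then have "Poly_Mapping.lookup p k = 0"
      using assms by (auto simp: deg_le_def multis_def in_keys_iff)
    moreover have "\<gamma> \<noteq> k" if "\<gamma> \<in> multis d" for \<gamma> using that False by auto
    ultimately show ?thesis by (simp add: when_def)
  qed
  then show "Poly_Mapping.lookup p k = Poly_Mapping.lookup (\<Sum>\<gamma>\<in>multis d. scalem (Poly_Mapping.lookup p \<gamma>) (Poly_Mapping.single \<gamma> 1)) k"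
    by (simp add: lookup_sum lookup_scalem lookup_single)
qed

lemma lookup_opA:
  assumes "deg_le p d"
  shows "Poly_Mapping.lookup (opA a p) \<beta> =
    (\<Sum>\<gamma>\<in>multis d. Poly_Mapping.lookup p \<gamma> * Poly_Mapping.lookup (opA a (Poly_Mapping.single \<gamma> 1)) \<beta>)"
proof -
  have "opA a p = opA a (\<Sum>\<gamma>\<in>multis d. scalem (Poly_Mapping.lookup p \<gamma>) (Poly_Mapping.single \<gamma> 1))"
    using mpoly_eq_sum_multis[OF assms] by simp
  then show ?thesis
    by (simp only: opA_sum opA_scalem lookup_sum lookup_scalem)
qed

lemma lookup_outside: "deg_le p d \<Longrightarrow> \<beta> \<notin> multis d \<Longrightarrow> Poly_Mapping.lookup p \<beta> = 0"
  by (auto simp: deg_le_def multis_def in_keys_iff)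

section \<open>The exponential series of A\<close>

context
  fixes a :: "('n::finite \<Rightarrow> nat) \<Rightarrow> 'n mpoly"
  assumes deg_a: "\<forall>\<alpha>. deg_le (a \<alpha>) (mdeg \<alpha>)"
begin

lemma deg_le_opA_pow: "deg_le p d \<Longrightarrow> deg_le ((opA a ^^ k) p) d"
  by (induction k) (auto intro: deg_le_opA[OF deg_a])

text \<open>The sum of absolute coefficients is a norm on polynomials of degree at most d, and A
  enlarges it at most by the sum M of the absolute values of its matrix entries.\<close>

lemma opA_pow_bound:
  assumes "deg_le p d"
  shows "\<exists>C M. \<forall>k \<beta>. \<bar>Poly_Mapping.lookup ((opA a ^^ k) p) \<beta>\<bar> \<le> C * M ^ k"
proof -
  define N where "N q = (\<Sum>\<beta>\<in>multis d. \<bar>Poly_Mapping.lookup q \<beta>\<bar>)" for q :: "'n mpoly"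
  define M where "M = (\<Sum>\<beta>\<in>multis d. \<Sum>\<gamma>\<in>multis d. \<bar>Poly_Mapping.lookup (opA a (Poly_Mapping.single \<gamma> 1)) \<beta>\<bar>)"
  have le_N: "\<bar>Poly_Mapping.lookup q \<beta>\<bar> \<le> N q" if "deg_le q d" for q \<beta>
  proof (cases "\<beta> \<in> multis d")
    case True then show ?thesis unfolding N_def by (intro member_le_sum) auto
  next
    case False then show ?thesis using lookup_outside[OF that False] by (simp add: N_def sum_nonneg)
  qed
  have step: "N (opA a q) \<le> M * N q" if "deg_le q d" for q
  proof -
    have "N (opA a q) \<le> (\<Sum>\<beta>\<in>multis d. \<Sum>\<gamma>\<in>multis d. \<bar>Poly_Mapping.lookup (opA a (Poly_Mapping.single \<gamma> 1)) \<beta>\<bar> * N q)"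
      unfolding N_def[of "opA a q"] lookup_opA[OF that]
      by (intro sum_mono order_trans[OF sum_abs])
         (auto simp: abs_mult mult.commute[of "\<bar>Poly_Mapping.lookup q _\<bar>"] intro!: mult_left_mono le_N that)
    then show ?thesis by (simp add: M_def sum_distrib_right)
  qed
  have "M \<ge> 0" by (simp add: M_def sum_nonneg)
  have "N ((opA a ^^ k) p) \<le> N p * M ^ k" for k
  proof (induction k)
    case (Suc k)
    have "N ((opA a ^^ Suc k) p) \<le> M * N ((opA a ^^ k) p)"
      using step[OF deg_le_opA_pow[OF assms]] by simp
    also have "\<dots> \<le> M * (N p * M ^ k)"
      using Suc \<open>M \<ge> 0\<close> by (intro mult_left_mono)
    finally show ?case by (simp add: mult_ac)
  qed simp
  then show ?thesis
    using le_N[OF deg_le_opA_pow[OF assms]] order_trans by blast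
qed

lemma summable_expA:
  "summable (\<lambda>k. t ^ k / fact k * Poly_Mapping.lookup ((opA a ^^ k) p) \<beta>)"
proof -
  obtain d where "deg_le p d" using ex_deg_le by blast
  then obtain C M where CM: "\<bar>Poly_Mapping.lookup ((opA a ^^ k) p) \<beta>\<bar> \<le> C * M ^ k" for k
    using opA_pow_bound by blast
  have "summable (\<lambda>k. C * (inverse (fact k) * (\<bar>t\<bar> * M) ^ k))"
    by (intro summable_mult summable_exp)
  then show ?thesis
  proof (rule summable_comparison_test')
    fix k :: nat
    have "norm (t ^ k / fact k * Poly_Mapping.lookup ((opA a ^^ k) p) \<beta>) =
        (\<bar>t\<bar> ^ k / fact k) * \<bar>Poly_Mapping.lookup ((opA a ^^ k) p) \<beta>\<bar>"
      by (simp add: abs_mult power_abs)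
    also have "\<dots> \<le> (\<bar>t\<bar> ^ k / fact k) * (C * M ^ k)"
      by (intro mult_left_mono CM) auto
    finally show "norm (t ^ k / fact k * Poly_Mapping.lookup ((opA a ^^ k) p) \<beta>) \<le>
        C * (inverse (fact k) * (\<bar>t\<bar> * M) ^ k)"
      by (simp add: power_mult_distrib field_simps)
  qed
qed

lemma lookup_expA:
  "Poly_Mapping.lookup (expA a t p) \<beta> = (suminf (\<lambda>k. t ^ k / fact k * Poly_Mapping.lookup ((opA a ^^ k) p) \<beta>))"
proof -
  obtain d where d: "deg_le p d" using ex_deg_le by blast
  have "{\<beta>. (suminf (\<lambda>k. t ^ k / fact k * Poly_Mapping.lookup ((opA a ^^ k) p) \<beta>)) \<noteq> 0} \<subseteq> multis d"
    using lookup_outside[OF deg_le_opA_pow[OF d]] by fastforce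
  then have "finite {\<beta>. (suminf (\<lambda>k. t ^ k / fact k * Poly_Mapping.lookup ((opA a ^^ k) p) \<beta>)) \<noteq> 0}"
    using finite_subset finite_multis by blast
  then show ?thesis by (simp add: expA_def)
qed

lemma deg_le_expA:
  assumes "deg_le p d"
  shows "deg_le (expA a t p) d"
  unfolding deg_le_def
proof (rule ballI)
  fix \<beta> assume "\<beta> \<in> Poly_Mapping.keys (expA a t p)"
  then have "(suminf (\<lambda>k. t ^ k / fact k * Poly_Mapping.lookup ((opA a ^^ k) p) \<beta>)) \<noteq> 0"
    by (simp add: in_keys_iff lookup_expA)
  then show "mdeg \<beta> \<le> d"
    using lookup_outside[OF deg_le_opA_pow[OF assms], of \<beta>] by (force simp: multis_def)
qed

lemma expA_0: "expA a 0 p = p"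
proof (rule poly_mapping_eqI)
  fix \<beta>
  have "(suminf (\<lambda>k. (0::real) ^ k / fact k * Poly_Mapping.lookup ((opA a ^^ k) p) \<beta>)) =
        (suminf (\<lambda>k. Poly_Mapping.lookup ((opA a ^^ k) p) \<beta> / fact k * 0 ^ k))"
    by (simp add: mult_ac)
  also have "\<dots> = Poly_Mapping.lookup p \<beta>"
    by (subst powser_zero) simp
  finally show "Poly_Mapping.lookup (expA a 0 p) \<beta> = Poly_Mapping.lookup p \<beta>"
    by (simp add: lookup_expA)
qed

text \<open>Each coefficient is an everywhere convergent power series in t. In its termwise
  derivative the new factor cancels against the factorial, and one application of A to p is left
  over.\<close>

lemma lookup_expA_deriv:
  "((\<lambda>t. Poly_Mapping.lookup (expA a t p) \<beta>) has_real_derivative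
     Poly_Mapping.lookup (expA a t (opA a p)) \<beta>) (at t)"
proof -
  define c where "c k = Poly_Mapping.lookup ((opA a ^^ k) p) \<beta> / fact k" for k
  have "((\<lambda>t. suminf (\<lambda>k. c k * t ^ k)) has_real_derivative (suminf (\<lambda>k. diffs c k * t ^ k))) (at t)"
  proof (rule termdiffs_strong_converges_everywhere)
    show "summable (\<lambda>k. c k * t ^ k)" for t
      using summable_expA[of t p \<beta>] by (simp add: c_def mult_ac)
  qed
  moreover have "diffs c k * t ^ k = t ^ k / fact k * Poly_Mapping.lookup ((opA a ^^ k) (opA a p)) \<beta>" for k
    unfolding diffs_def c_def funpow_Suc_right o_apply fact_Suc by (simp del: of_nat_Suc)
  moreover have "(suminf (\<lambda>k. c k * t ^ k)) = Poly_Mapping.lookup (expA a t p) \<beta>" for t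
    by (simp add: c_def lookup_expA mult_ac)
  ultimately show ?thesis
    by (simp add: lookup_expA)
qed

text \<open>A acts on finitely many coefficients by a fixed matrix, which may be moved through the
  series. The time derivative thereby becomes A applied to the current polynomial, as the maximum
  principle requires.\<close>

lemma opA_expA: "opA a (expA a t p) = expA a t (opA a p)"
proof (rule poly_mapping_eqI)
  fix \<beta>
  obtain d where d: "deg_le p d" using ex_deg_le by blast
  let ?B = "\<lambda>\<gamma>. Poly_Mapping.lookup (opA a (Poly_Mapping.single \<gamma> 1)) \<beta>"
  let ?f = "\<lambda>\<gamma> k. t ^ k / fact k * Poly_Mapping.lookup ((opA a ^^ k) p) \<gamma>"
  have "Poly_Mapping.lookup (opA a (expA a t p)) \<beta> = (\<Sum>\<gamma>\<in>multis d. (suminf (\<lambda>k. ?f \<gamma> k)) * ?B \<gamma>)"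
    by (simp add: lookup_opA[OF deg_le_expA[OF d]] lookup_expA)
  also have "\<dots> = (\<Sum>\<gamma>\<in>multis d. suminf (\<lambda>k. ?f \<gamma> k * ?B \<gamma>))"
    by (intro sum.cong refl suminf_mult2 summable_expA)
  also have "\<dots> = (suminf (\<lambda>k. \<Sum>\<gamma>\<in>multis d. ?f \<gamma> k * ?B \<gamma>))"
    by (intro suminf_sum[symmetric] summable_mult2 summable_expA)
  also have "\<dots> = Poly_Mapping.lookup (expA a t (opA a p)) \<beta>"
    unfolding lookup_expA
  proof (intro arg_cong[where f=suminf] ext)
    fix k
    have "(opA a ^^ k) (opA a p) = opA a ((opA a ^^ k) p)"
      by (simp add: funpow_swap1)
    then show "(\<Sum>\<gamma>\<in>multis d. ?f \<gamma> k * ?B \<gamma>) =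
        t ^ k / fact k * Poly_Mapping.lookup ((opA a ^^ k) (opA a p)) \<beta>"
      by (simp add: lookup_opA[OF deg_le_opA_pow[OF d]] sum_distrib_left mult_ac)
  qed
  finally show "Poly_Mapping.lookup (opA a (expA a t p)) \<beta> = Poly_Mapping.lookup (expA a t (opA a p)) \<beta>" .
qed

lemma poly_eval_expA_deriv:
  "((\<lambda>t. poly_eval (expA a t p) y) has_real_derivative poly_eval (opA a (expA a t p)) y) (at t)"
proof -
  obtain d where d: "deg_le p d" using ex_deg_le by blast
  show ?thesis
    unfolding opA_expA poly_eval_deg_le[OF deg_le_expA[OF d]]
      poly_eval_deg_le[OF deg_le_expA[OF deg_le_opA[OF deg_a d]]]
    by (intro DERIV_sum DERIV_cmult_right lookup_expA_deriv)
qed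

lemma preserver_imp_pos_min:
  assumes "\<forall>t\<ge>0. expA a t ` Pos \<subseteq> Pos"
  shows "pos_min a y"
  unfolding pos_min_def
proof (intro ballI impI)
  fix q :: "'n mpoly" assume q: "q \<in> Pos" and 0: "poly_eval q y = 0"
  let ?f = "\<lambda>t. poly_eval (expA a t q) y"
  have D: "(?f has_real_derivative poly_eval (opA a q) y) (at 0)"
    using poly_eval_expA_deriv[of q y 0] by (simp add: expA_0)
  have pos: "?f t \<ge> 0" if "t \<ge> 0" for t
    using assms q that by (auto simp: Pos_def)
  show "0 \<le> poly_eval (opA a q) y"
  proof (rule ccontr)
    assume "\<not> ?thesis"
    \<comment> \<open>A negative derivative would push the value below its initial value 0 at small
      positive times.\<close>
    then obtain d where "d > 0" and d: "\<forall>h>0. h < d \<longrightarrow> ?f (0 + h) < ?f 0"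
      using DERIV_neg_dec_right[OF D] by auto
    then have "?f (d / 2) < 0"
      using 0 by (auto simp: expA_0 dest: spec[of _ "d / 2"])
    with pos[of "d / 2"] \<open>d > 0\<close> show False by simp
  qed
qed

end

section \<open>A polynomial weight that dominates near infinity\<close>

lemma mono_eval_bound:
  assumes "\<And>i. \<bar>y $ i\<bar> \<le> B" "1 \<le> B" "mdeg \<beta> \<le> d"
  shows "\<bar>mono_eval \<beta> y\<bar> \<le> B ^ d"
proof -
  have "\<bar>mono_eval \<beta> y\<bar> = (\<Prod>i\<in>UNIV. \<bar>y $ i\<bar> ^ \<beta> i)"
    by (simp add: mono_eval_def abs_prod power_abs)
  also have "\<dots> \<le> (\<Prod>i\<in>UNIV. B ^ \<beta> i)"
    using assms by (intro prod_mono conjI power_mono) auto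
  also have "\<dots> = B ^ mdeg \<beta>" by (simp add: mdeg_def power_sum)
  also have "\<dots> \<le> B ^ d" using assms by (intro power_increasing)
  finally show ?thesis .
qed

text \<open>The even coordinate powers make the weight grow like the 2m-th power of the maximum norm
  in every direction, and the constant keeps it positive.\<close>

definition weight_poly :: "nat \<Rightarrow> 'n::finite mpoly" where
  "weight_poly m = Poly_Mapping.single 0 1 +
     (\<Sum>i\<in>UNIV. Poly_Mapping.single (\<lambda>j. if j = i then 2 * m else 0) 1)"

lemma poly_eval_weight: "poly_eval (weight_poly m) y = 1 + (\<Sum>i\<in>UNIV. (y $ i) ^ (2 * m))"
  by (simp add: weight_poly_def poly_eval_add poly_eval_sum mono_eval_def del: single_one)
     (simp add: if_distrib[of "\<lambda>k. _ ^ k"] prod.delta cong: if_cong)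

lemma deg_le_weight: "deg_le (weight_poly m) (2 * m)"
  unfolding weight_poly_def
  by (intro deg_le_add deg_le_sum deg_le_single) (auto simp: mdeg_def sum.delta)

text \<open>B is the larger of 1 and the maximum norm of y. The constant term covers the first
  possibility, the power of a maximal coordinate the second.\<close>

lemma weight_ge:
  fixes y :: "real^'n::finite"
  obtains B where "1 \<le> B" "\<And>i. \<bar>y $ i\<bar> \<le> B" "B ^ (2 * m) \<le> poly_eval (weight_poly m) y"
proof
  define B where "B = Max (insert 1 (range (\<lambda>i. \<bar>y $ i\<bar>)))"
  show "1 \<le> B" by (simp add: B_def)
  show "\<bar>y $ i\<bar> \<le> B" for i unfolding B_def by (intro Max_ge) auto
  have "B \<in> insert 1 (range (\<lambda>i. \<bar>y $ i\<bar>))"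
    unfolding B_def by (intro Max_in) auto
  then show "B ^ (2 * m) \<le> poly_eval (weight_poly m) y"
  proof
    assume "B = 1" then show ?thesis by (auto simp: poly_eval_weight power_mult intro!: sum_nonneg)
  next
    assume "B \<in> range (\<lambda>i. \<bar>y $ i\<bar>)"
    then obtain i where "B = \<bar>y $ i\<bar>" by auto
    then have "B ^ (2 * m) = (y $ i) ^ (2 * m)" by (simp add: power_mult)
    also have "\<dots> \<le> (\<Sum>i\<in>UNIV. (y $ i) ^ (2 * m))"
      by (intro member_le_sum) (auto simp: power_mult)
    finally show ?thesis by (simp add: poly_eval_weight)
  qed
qed

lemma weight_pos: "poly_eval (weight_poly m) y > 0"
  by (auto simp: poly_eval_weight power_mult intro!: add_pos_nonneg sum_nonneg)

lemma abs_poly_eval_le: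
  assumes "deg_le p d" "\<And>\<beta>. mdeg \<beta> \<le> d \<Longrightarrow> \<bar>mono_eval \<beta> y\<bar> \<le> K"
  shows "\<bar>poly_eval p y\<bar> \<le> (\<Sum>\<beta>\<in>multis d. \<bar>Poly_Mapping.lookup p \<beta>\<bar>) * K"
  unfolding poly_eval_deg_le[OF assms(1)] sum_distrib_right
  using assms(2) by (intro order_trans[OF sum_abs] sum_mono) (auto simp: abs_mult multis_def intro!: mult_left_mono)

lemma continuous_on_mono_eval [continuous_intros]:
  "continuous_on S g \<Longrightarrow> continuous_on S (\<lambda>x. mono_eval \<beta> (g x))"
  unfolding mono_eval_def by (intro continuous_intros)

text \<open>With B from \<open>weight_ge\<close>, q is at most S B^d and the weight at least B^(2 d
  + 2); a spare factor B beats S / \<epsilon> once y is far out. The radius depends on q only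
  through S, so a common coefficient bound yields one radius for all times.\<close>

lemma weight_dominates:
  fixes y :: "real^'n::finite"
  assumes "deg_le q d" "(\<Sum>\<beta>\<in>multis d. \<bar>Poly_Mapping.lookup q \<beta>\<bar>) \<le> S" "0 < \<epsilon>"
    and y: "real CARD('n) * (S / \<epsilon>) < norm y"
  shows "\<bar>poly_eval q y\<bar> < \<epsilon> * poly_eval (weight_poly (Suc d)) y"
proof -
  obtain B where B: "1 \<le> B" "\<And>i. \<bar>y $ i\<bar> \<le> B" "B ^ (2 * Suc d) \<le> poly_eval (weight_poly (Suc d)) y"
    using weight_ge by blast
  have "norm y \<le> (\<Sum>i\<in>UNIV. \<bar>y $ i\<bar>)"
    by (rule norm_le_l1_cart)
  also have "\<dots> \<le> (\<Sum>i\<in>(UNIV::'n set). B)"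
    using B(2) by (intro sum_mono)
  finally have "real CARD('n) * (S / \<epsilon>) < real CARD('n) * B"
    using y by simp
  then have "S < \<epsilon> * B" using \<open>0 < \<epsilon>\<close> by (simp add: field_simps)
  have "\<bar>poly_eval q y\<bar> \<le> S * B ^ d"
    by (rule order_trans[OF abs_poly_eval_le[OF assms(1), of y "B ^ d"]])
       (use B assms in \<open>auto intro!: mono_eval_bound mult_right_mono\<close>)
  also have "\<dots> < \<epsilon> * B * B ^ d"
    using \<open>S < \<epsilon> * B\<close> B(1) by (intro mult_strict_right_mono) auto
  also have "\<dots> = \<epsilon> * B ^ Suc d" by simp
  also have "\<dots> \<le> \<epsilon> * B ^ (2 * Suc d)"
    using B(1) \<open>0 < \<epsilon>\<close> by (intro mult_left_mono power_increasing) auto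
  also have "\<dots> \<le> \<epsilon> * poly_eval (weight_poly (Suc d)) y"
    using B(3) \<open>0 < \<epsilon>\<close> by (intro mult_left_mono) auto
  finally show ?thesis .
qed

text \<open>Maximum principle argument: \<open>u t = e\<^sup>t\<^sup>A p + \<epsilon> e\<^sup>\<lambda>\<^sup>t w\<close> is positive near infinity since the
  weight \<open>w\<close> has higher degree than \<open>p\<close>, so a sign change would first occur as a zero \<open>(t0, y0)\<close> with
  \<open>\<partial>\<^sub>t u \<le> 0\<close>; but there \<open>\<partial>\<^sub>t u = A u + \<epsilon> e\<^sup>\<lambda>\<^sup>t (\<lambda> w - A w) > 0\<close> once \<open>A w < \<lambda> w\<close>.\<close>

lemma pos_min_imp_preserver:
  fixes a :: "('n::finite \<Rightarrow> nat) \<Rightarrow> 'n mpoly"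
  assumes deg_a: "\<forall>\<alpha>. deg_le (a \<alpha>) (mdeg \<alpha>)" and pm: "\<And>y. pos_min a y"
    and "T \<ge> 0" "p \<in> Pos"
  shows "expA a T p \<in> Pos"
proof (rule ccontr)
  assume "expA a T p \<notin> Pos"
  then obtain y1 where y1: "poly_eval (expA a T p) y1 < 0" by (auto simp: Pos_def not_le)
  obtain d where d: "deg_le p d" using ex_deg_le by blast
  define w :: "'n mpoly" where "w = weight_poly (Suc d)"
  have w_pos: "poly_eval w y > 0" for y unfolding w_def by (rule weight_pos)
  \<comment> \<open>\<open>l - 1\<close> bounds the ratio of A w to w, because A w has no higher
    degree than w and each monomial up to that degree is at most w in absolute value. The added 1
    makes the comparison strict.\<close>
  define l where "l = (\<Sum>\<beta>\<in>multis (2 * Suc d). \<bar>Poly_Mapping.lookup (opA a w) \<beta>\<bar>) + 1"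
  have l: "poly_eval (opA a w) y < l * poly_eval w y" for y
  proof -
    have "\<bar>mono_eval \<beta> y\<bar> \<le> poly_eval w y" if "mdeg \<beta> \<le> 2 * Suc d" for \<beta>
    proof -
      obtain B where "1 \<le> B" "\<And>i. \<bar>y $ i\<bar> \<le> B" "B ^ (2 * Suc d) \<le> poly_eval w y"
        unfolding w_def using weight_ge by blast
      with mono_eval_bound[of y B \<beta> "2 * Suc d"] that show ?thesis by (meson order_trans)
    qed
    then have "\<bar>poly_eval (opA a w) y\<bar> \<le> (l - 1) * poly_eval w y"
      using abs_poly_eval_le[OF deg_le_opA[OF deg_a deg_le_weight], of "Suc d" y "poly_eval w y"]
      by (simp add: l_def w_def)
    with w_pos[of y] show ?thesis by (simp add: algebra_simps)
  qed
  \<comment> \<open>With this choice the perturbation cancels exactly half of the negative value at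
    (T, y1), which therefore stays negative.\<close>
  define \<epsilon> where "\<epsilon> = - poly_eval (expA a T p) y1 / (2 * exp (l * T) * poly_eval w y1)"
  have "\<epsilon> > 0" unfolding \<epsilon>_def using y1 w_pos by (intro divide_pos_pos mult_pos_pos) auto
  define U where "U t = expA a t p + scalem (\<epsilon> * exp (l * t)) w" for t
  define u where "u t y = poly_eval (U t) y" for t y
  have u_eq: "u t y = poly_eval (expA a t p) y + \<epsilon> * exp (l * t) * poly_eval w y" for t y
    by (simp add: u_def U_def poly_eval_add poly_eval_scalem)
  have u1: "u T y1 < 0"
    using y1 w_pos[of y1] by (simp add: u_eq \<epsilon>_def field_simps)
  have u_deriv: "((\<lambda>t. u t y) has_real_derivative
      (poly_eval (opA a (U t)) y + \<epsilon> * exp (l * t) * (l * poly_eval w y - poly_eval (opA a w) y))) (at t)" for t y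
    unfolding u_eq U_def opA_add opA_scalem poly_eval_add poly_eval_scalem
    by (rule derivative_eq_intros refl poly_eval_expA_deriv[OF deg_a])+ (simp add: algebra_simps)
  have cont_lookup: "continuous_on A (\<lambda>t. Poly_Mapping.lookup (expA a t p) \<beta>)" for A \<beta>
    using DERIV_isCont[OF lookup_expA_deriv[OF deg_a]] by (blast intro: continuous_at_imp_continuous_on)
  have "continuous_on {0..T} (\<lambda>t. \<Sum>\<beta>\<in>multis d. \<bar>Poly_Mapping.lookup (expA a t p) \<beta>\<bar>)"
    by (intro continuous_intros cont_lookup)
  from continuous_attains_sup[OF compact_Icc _ this] \<open>T \<ge> 0\<close>
  obtain t' where "\<forall>t\<in>{0..T}. (\<Sum>\<beta>\<in>multis d. \<bar>Poly_Mapping.lookup (expA a t p) \<beta>\<bar>)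
      \<le> (\<Sum>\<beta>\<in>multis d. \<bar>Poly_Mapping.lookup (expA a t' p) \<beta>\<bar>)"
    by auto
  then obtain S0 where S0: "\<And>t. t \<in> {0..T} \<Longrightarrow> (\<Sum>\<beta>\<in>multis d. \<bar>Poly_Mapping.lookup (expA a t p) \<beta>\<bar>) \<le> S0"
    by blast
  \<comment> \<open>A lower bound on {0..T} for the factor of w in u; with S0 it yields the same
    radius R for all these times.\<close>
  define E where "E = \<epsilon> * exp (- \<bar>l\<bar> * T)"
  define R where "R = real CARD('n) * (S0 / E)"
  have "E > 0" using \<open>\<epsilon> > 0\<close> by (simp add: E_def)
  have far: "u t y > 0" if "t \<in> {0..T}" "norm y > R" for t y
  proof -
    have "- \<bar>l\<bar> * T \<le> l * t"
    proof -
      have "- (l * t) \<le> \<bar>l\<bar> * t"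
        using that(1) by (metis abs_ge_minus_self atLeastAtMost_iff mult_minus_left mult_right_mono)
      also have "\<dots> \<le> \<bar>l\<bar> * T"
        using that(1) by (intro mult_left_mono) auto
      finally show ?thesis by simp
    qed
    then have "E \<le> \<epsilon> * exp (l * t)"
      using \<open>\<epsilon> > 0\<close> by (simp add: E_def)
    then have "E * poly_eval w y \<le> \<epsilon> * exp (l * t) * poly_eval w y"
      using w_pos[of y] by (intro mult_right_mono) auto
    moreover have "\<bar>poly_eval (expA a t p) y\<bar> < E * poly_eval w y"
      unfolding w_def
      by (rule weight_dominates[OF deg_le_expA[OF deg_a d] S0[OF that(1)] \<open>E > 0\<close>]) (use that in \<open>simp add: R_def\<close>)
    ultimately show ?thesis by (simp add: u_eq)
  qed
  define K where "K = {0..T} \<times> cball (0::real^'n) R"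
  \<comment> \<open>By \<open>far\<close> every point with u \<le> 0 and time in {0..T} lies over
    the ball, so this compact set misses no failure and contains one of least time.\<close>
  define Z where "Z = {z \<in> K. u (fst z) (snd z) \<le> 0}"
  have "continuous_on K (\<lambda>z. u (fst z) (snd z))"
    unfolding u_eq poly_eval_deg_le[OF deg_le_expA[OF deg_a d]] poly_eval_deg_le[OF deg_le_weight] w_def
    by (intro continuous_intros continuous_on_compose2[OF cont_lookup]) auto
  then have "closed Z"
    unfolding Z_def
    using continuous_on_closed_Collect_le[of K "\<lambda>z. u (fst z) (snd z)" "\<lambda>_. 0"]
    by (simp add: K_def closed_Times)
  moreover have "compact K" unfolding K_def by (intro compact_Times) auto
  ultimately have "compact Z"
    using compact_Int_closed[of K Z] by (simp add: Z_def Int_def)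
  moreover have "(T, y1) \<in> Z"
    using u1 far[of T y1] \<open>T \<ge> 0\<close> by (force simp: Z_def K_def)
  ultimately obtain z where "z \<in> Z" and z: "\<And>z'. z' \<in> Z \<Longrightarrow> fst z \<le> fst z'"
    using continuous_attains_inf[of Z fst] continuous_on_fst[OF continuous_on_id] by blast
  define t0 y0 where "t0 = fst z" and "y0 = snd z"
  have t0: "0 \<le> t0" "t0 \<le> T" and "u t0 y0 \<le> 0"
    using \<open>z \<in> Z\<close> by (auto simp: Z_def K_def t0_def y0_def)
  have before: "u t y > 0" if "0 \<le> t" "t < t0" for t y
  proof (rule ccontr)
    assume "\<not> u t y > 0"
    then have "(t, y) \<in> Z"
      using far[of t y] that t0 by (force simp: Z_def K_def)
    then show False using z[of "(t, y)"] that by (simp add: t0_def)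
  qed
  have "u 0 y > 0" for y
    using \<open>p \<in> Pos\<close> w_pos[of y] \<open>\<epsilon> > 0\<close> by (auto simp: u_eq expA_0[OF deg_a] Pos_def intro!: add_nonneg_pos)
  with \<open>u t0 y0 \<le> 0\<close> have "t0 > 0" using t0(1) by (metis less_eq_real_def not_le)
  have "u t0 y \<ge> 0" for y
  proof -
    have "((\<lambda>t. u t y) \<longlongrightarrow> u t0 y) (at_left t0)"
      using DERIV_isCont[OF u_deriv] by (simp add: isCont_def filterlim_at_split)
    moreover have "eventually (\<lambda>t. 0 \<le> u t y) (at_left t0)"
      unfolding eventually_at_left[OF \<open>t0 > 0\<close>] using before \<open>t0 > 0\<close> by (auto intro!: exI[of _ 0] less_imp_le)
    ultimately show ?thesis
      by (intro tendsto_lowerbound[where f="\<lambda>t. u t y"]) auto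
  qed
  then have "U t0 \<in> Pos" and "poly_eval (U t0) y0 = 0"
    using \<open>u t0 y0 \<le> 0\<close> by (auto simp: Pos_def u_def intro: antisym)
  then have "poly_eval (opA a (U t0)) y0 \<ge> 0"
    using pm[of y0] by (auto simp: pos_min_def)
  moreover have "\<epsilon> * exp (l * t0) * (l * poly_eval w y0 - poly_eval (opA a w) y0) > 0"
    using \<open>\<epsilon> > 0\<close> l[of y0] by (intro mult_pos_pos) auto
  \<comment> \<open>A zero with positive time derivative is preceded by negative values, contrary to
    \<open>before\<close>; t0 > 0 leaves room for such an earlier time.\<close>
  ultimately obtain h where h: "h > 0" "\<forall>k>0. k < h \<longrightarrow> u (t0 - k) y0 < u t0 y0"
    using DERIV_pos_inc_left[OF u_deriv[of y0 t0]] by auto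
  define k where "k = min (h / 2) t0"
  have "0 < k" "k < h" "k \<le> t0" using h \<open>t0 > 0\<close> by (auto simp: k_def)
  then have "u (t0 - k) y0 < 0" using h \<open>u t0 y0 \<le> 0\<close> by force
  with before[of "t0 - k" y0] \<open>0 < k\<close> \<open>k \<le> t0\<close> show False by auto
qed

section \<open>Cones and weak limits\<close>

text \<open>First-order condition at a minimum: divide by 2 s and let s tend to 0. The range s \<le>
  1 suits variations that shrink a cone element by the factor 1 - s.\<close>

lemma quadratic_nonneg_imp_linear_nonneg:
  fixes p q :: real
  assumes "\<And>s. 0 < s \<Longrightarrow> s \<le> 1 \<Longrightarrow> 0 \<le> 2 * s * p + s\<^sup>2 * q"
  shows "0 \<le> p"
proof (rule tendsto_lowerbound)
  have "((\<lambda>s. p + s * q / 2) \<longlongrightarrow> p + 0 * q / 2) (at_right 0)"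
    by (intro tendsto_intros) auto
  then show "((\<lambda>s. p + s * q / 2) \<longlongrightarrow> p) (at_right 0)" by simp
  have "0 \<le> p + s * q / 2" if "0 < s" "s < 1" for s
  proof -
    have "0 \<le> 2 * s * (p + s * q / 2)"
      using assms[of s] that by (simp add: algebra_simps power2_eq_square)
    with that show ?thesis by (simp add: zero_le_mult_iff)
  qed
  then show "\<forall>\<^sub>F s in at_right 0. 0 \<le> p + s * q / 2"
    by (auto simp: eventually_at_right_field intro!: exI[of _ 1])
qed simp

text \<open>The functional \<open>v\<close> separating \<open>L\<close> from the cone generated by the \<open>f x\<close> is the limit of the
  differences \<open>L - c n\<close> along a minimising sequence, Cauchy by the parallelogram law.\<close>

lemma cone_approximation:
  fixes f :: "'x \<Rightarrow> 'j \<Rightarrow> real" and L :: "'j \<Rightarrow> real"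
  assumes J: "finite J" and "\<epsilon> > 0"
    and sep: "\<And>v. (\<And>x. 0 \<le> (\<Sum>j\<in>J. v j * f x j)) \<Longrightarrow> 0 \<le> (\<Sum>j\<in>J. v j * L j)"
  obtains S w where "finite S" "\<And>x. (0::real) \<le> w x"
    "\<And>j. j \<in> J \<Longrightarrow> \<bar>(\<Sum>x\<in>S. w x * f x j) - L j\<bar> < \<epsilon>"
proof (rule ccontr)
  note main = that
  assume contra: "\<not> thesis"
  define C where "C = {c. \<exists>S w. finite S \<and> (\<forall>x. (0::real) \<le> w x) \<and> c = (\<lambda>j. \<Sum>x\<in>S. w x * f x j)}"
  have C_f: "f x \<in> C" for x
    unfolding C_def by (auto intro!: exI[of _ "{x}"] exI[of _ "\<lambda>_. 1"])
  have C_scale: "(\<lambda>j. s * c j) \<in> C" if c: "c \<in> C" and s: "0 \<le> s" for c s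
  proof -
    obtain S w where "finite S" "\<forall>x. (0::real) \<le> w x" "c = (\<lambda>j. \<Sum>x\<in>S. w x * f x j)"
      using c by (auto simp: C_def)
    then show ?thesis
      unfolding C_def using s
      by (auto simp: sum_distrib_left mult_ac intro!: exI[of _ S] exI[of _ "\<lambda>x. s * w x"])
  qed
  have C_add: "(\<lambda>j. c j + c' j) \<in> C" if c: "c \<in> C" "c' \<in> C" for c c'
  proof -
    obtain S w where S: "finite S" "\<forall>x. (0::real) \<le> w x" "c = (\<lambda>j. \<Sum>x\<in>S. w x * f x j)"
      using c by (auto simp: C_def)
    obtain S' w' where S': "finite S'" "\<forall>x. (0::real) \<le> w' x" "c' = (\<lambda>j. \<Sum>x\<in>S'. w' x * f x j)"
      using c by (auto simp: C_def)
    let ?w = "\<lambda>x. (if x \<in> S then w x else 0) + (if x \<in> S' then w' x else 0)"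
    have *: "(\<Sum>x\<in>S \<union> S'. (if x \<in> T then g x else 0) * f x j) = (\<Sum>x\<in>T. g x * f x j)"
      if "T \<subseteq> S \<union> S'" for T g j
      using that S S' by (intro sum.mono_neutral_cong_right) auto
    have "c j + c' j = (\<Sum>x\<in>S \<union> S'. ?w x * f x j)" for j
      using S S' by (simp only: distrib_right sum.distrib *[OF Un_upper1] *[OF Un_upper2])
    then show ?thesis
      unfolding C_def using S(1,2) S'(1,2) by (auto intro!: exI[of _ "S \<union> S'"] exI[of _ ?w])
  qed
  define ip where "ip g h = (\<Sum>j\<in>J. g j * h j)" for g h :: "'j \<Rightarrow> real"
  define N where "N g = ip g g" for g :: "'j \<Rightarrow> real"
  have N_nonneg: "0 \<le> N g" for g by (simp add: N_def ip_def sum_nonneg)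
  have N_lin: "N (\<lambda>j. g j + s * h j) = N g + 2 * s * ip g h + s\<^sup>2 * N h" for g s h
    by (simp add: N_def ip_def algebra_simps sum.distrib sum_distrib_left power2_eq_square)
  have far: "\<epsilon>\<^sup>2 \<le> N (\<lambda>j. L j - c j)" if c: "c \<in> C" for c
  proof -
    obtain S w where S: "finite S" "\<forall>x. (0::real) \<le> w x" "c = (\<lambda>j. \<Sum>x\<in>S. w x * f x j)"
      using c by (auto simp: C_def)
    have "\<exists>j\<in>J. \<not> \<bar>c j - L j\<bar> < \<epsilon>"
      using S contra main[of S w] by auto
    then obtain j where j: "j \<in> J" "\<not> \<bar>c j - L j\<bar> < \<epsilon>" by blast
    then have "\<epsilon>\<^sup>2 \<le> (L j - c j)\<^sup>2"
      using \<open>\<epsilon> > 0\<close> by (subst abs_le_square_iff[symmetric]) auto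
    also have "\<dots> \<le> N (\<lambda>j. L j - c j)"
      unfolding N_def ip_def power2_eq_square using J j(1)
      by (intro member_le_sum[of j J "\<lambda>j. (L j - c j) * (L j - c j)"]) auto
    finally show ?thesis .
  qed
  \<comment> \<open>The squared distance from L to the cone. It is positive, since each cone element
    misses L by at least \<epsilon> in some coordinate.\<close>
  define D where "D = Inf ((\<lambda>c. N (\<lambda>j. L j - c j)) ` C)"
  have bdd: "bdd_below ((\<lambda>c. N (\<lambda>j. L j - c j)) ` C)" using N_nonneg by (auto intro!: bdd_belowI[of _ 0])
  have D_le: "D \<le> N (\<lambda>j. L j - c j)" if "c \<in> C" for c
    unfolding D_def by (intro cInf_lower imageI that bdd)
  have "\<epsilon>\<^sup>2 \<le> D"
    unfolding D_def using C_f far by (intro cInf_greatest) auto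
  then have "D > 0" using \<open>\<epsilon> > 0\<close> by (meson less_le_trans zero_less_power)
  have "\<exists>c\<in>C. N (\<lambda>j. L j - c j) < D + 1 / real (Suc n)" for n
  proof -
    have "D < D + 1 / real (Suc n)" by simp
    then show ?thesis
      unfolding D_def using C_f by (subst (asm) cInf_less_iff[OF _ bdd]) (auto simp: D_def)
  qed
  then obtain c where c: "\<And>n. c n \<in> C" and c_N: "\<And>n. N (\<lambda>j. L j - c n j) < D + 1 / real (Suc n)"
    by metis
  define r where "r n j = L j - c n j" for n j
  have close: "(r m j - r n j)\<^sup>2 \<le> 2 / real (Suc m) + 2 / real (Suc n)" if "j \<in> J" for m n j
  proof -
    have "(\<lambda>j. 1/2 * (c m j + c n j)) \<in> C"
      by (intro C_scale C_add c) simp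
    then have mid: "D \<le> N (\<lambda>j. L j - 1/2 * (c m j + c n j))" by (rule D_le)
    have "(r m j - r n j)\<^sup>2 \<le> N (\<lambda>j. r m j - r n j)"
      unfolding N_def ip_def power2_eq_square using J that
      by (intro member_le_sum[of j J "\<lambda>j. (r m j - r n j) * (r m j - r n j)"]) auto
    also have "\<dots> = 2 * N (r m) + 2 * N (r n) - 4 * N (\<lambda>j. L j - 1/2 * (c m j + c n j))"
      unfolding N_def ip_def r_def sum_distrib_left sum.distrib[symmetric] sum_subtractf[symmetric]
      by (intro sum.cong refl) (simp add: algebra_simps)
    also have "\<dots> \<le> 2 / real (Suc m) + 2 / real (Suc n)"
      using mid c_N[of m] c_N[of n] by (simp add: r_def[abs_def])
    finally show ?thesis .
  qed
  have "\<exists>l. (\<lambda>n. r n j) \<longlonglongrightarrow> l" if j: "j \<in> J" for j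
  proof -
    have "Cauchy (\<lambda>n. r n j)"
    proof (rule metric_CauchyI)
      fix e :: real assume "e > 0"
      then obtain M where M: "inverse (real (Suc M)) < e\<^sup>2 / 4"
        using reals_Archimedean[of "e\<^sup>2 / 4"] by auto
      have "dist (r m j) (r n j) < e" if "m \<ge> M" "n \<ge> M" for m n
      proof -
        have "inverse (real (Suc m)) \<le> inverse (real (Suc M))" "inverse (real (Suc n)) \<le> inverse (real (Suc M))"
          using that by (auto intro!: le_imp_inverse_le)
        then have "(r m j - r n j)\<^sup>2 < e\<^sup>2"
          using close[OF j, of m n, unfolded divide_inverse] M by linarith
        then have "\<bar>r m j - r n j\<bar> < \<bar>e\<bar>" 
          using \<open>e > 0\<close> power2_less_imp_less[of "\<bar>r m j - r n j\<bar>" "\<bar>e\<bar>"] by simp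
        then show ?thesis using \<open>e > 0\<close> by (simp add: dist_real_def)
      qed
      then show "\<exists>M. \<forall>m\<ge>M. \<forall>n\<ge>M. dist (r m j) (r n j) < e" by blast
    qed
    then show ?thesis by (simp add: Cauchy_convergent_iff convergent_def)
  qed
  then obtain v where v: "\<And>j. j \<in> J \<Longrightarrow> (\<lambda>n. r n j) \<longlonglongrightarrow> v j" by metis
  have lim: "(\<lambda>n. N (\<lambda>j. g n j)) \<longlonglongrightarrow> N h" if "\<And>j. j \<in> J \<Longrightarrow> (\<lambda>n. g n j) \<longlonglongrightarrow> h j" for g h
    unfolding N_def ip_def by (intro tendsto_intros that)
  have "N v = D"
  proof (rule LIMSEQ_unique[OF lim[OF v]])
    have "(\<lambda>n. D + 1 / real (Suc n)) \<longlonglongrightarrow> D + 0"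
      by (intro tendsto_intros LIMSEQ_Suc[OF lim_1_over_n])
    moreover have "D \<le> N (\<lambda>j. r n j)" "N (\<lambda>j. r n j) \<le> D + 1 / real (Suc n)" for n
      using D_le[OF c[of n]] less_imp_le[OF c_N[of n]] unfolding r_def by this+
    ultimately show "(\<lambda>n. N (\<lambda>j. r n j)) \<longlonglongrightarrow> D"
      by (intro real_tendsto_sandwich[of "\<lambda>_. D" "\<lambda>n. N (\<lambda>j. r n j)" _ "\<lambda>n. D + 1 / real (Suc n)" D]
          always_eventually allI tendsto_const) simp_all
  qed
  \<comment> \<open>Adding s d to c n stays in the cone, so moving v in the direction -d cannot
    decrease its norm.\<close>
  have ip_C: "ip v d \<le> 0" if d: "d \<in> C" for d
  proof -
    have quad: "0 \<le> 2 * s * - ip v d + s\<^sup>2 * N d" if "0 < s" for s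
    proof -
      have "D \<le> N (\<lambda>j. r n j + (- s) * d j)" for n
        using D_le[OF C_add[OF c[of n] C_scale[OF d, of s]]] that by (simp add: r_def algebra_simps)
      moreover have "(\<lambda>n. N (\<lambda>j. r n j + (- s) * d j)) \<longlonglongrightarrow> N (\<lambda>j. v j + (- s) * d j)"
        by (intro lim tendsto_intros v)
      ultimately have "D \<le> N (\<lambda>j. v j + (- s) * d j)"
        by (intro LIMSEQ_le_const) auto
      then show ?thesis unfolding N_lin \<open>N v = D\<close> by simp
    qed
    have "0 \<le> - ip v d"
      by (rule quadratic_nonneg_imp_linear_nonneg[of "- ip v d" "N d"]) (rule quad)
    then show ?thesis by simp
  qed
  \<comment> \<open>On J this is the limit of the c n, which may lie outside the cone. Its pairing
    with v is therefore tested on the elements (1 - s) c n before passing to the limit.\<close>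
  define cc where "cc j = L j - v j" for j
  have "0 \<le> ip v cc"
  proof (rule quadratic_nonneg_imp_linear_nonneg[of _ "N cc"])
    fix s :: real assume s: "0 < s" "s \<le> 1"
    have "D \<le> N (\<lambda>j. r n j + s * c n j)" for n
      using D_le[OF C_scale[OF c[of n], of "1 - s"]] s by (simp add: r_def algebra_simps)
    moreover have "(\<lambda>n. L j - r n j) \<longlonglongrightarrow> cc j" if "j \<in> J" for j
      unfolding cc_def by (intro tendsto_intros v that)
    then have "(\<lambda>n. N (\<lambda>j. r n j + s * c n j)) \<longlonglongrightarrow> N (\<lambda>j. v j + s * cc j)"
      by (intro lim tendsto_intros v) (simp_all add: r_def)
    ultimately have "D \<le> N (\<lambda>j. v j + s * cc j)"
      by (intro LIMSEQ_le_const) auto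
    then show "0 \<le> 2 * s * ip v cc + s\<^sup>2 * N cc" unfolding N_lin \<open>N v = D\<close> by simp
  qed
  \<comment> \<open>Hence -v is non-negative on the cone but negative at L, contrary to
    \<open>sep\<close>.\<close>
  have "ip v L = N v + ip v cc"
    unfolding N_def ip_def sum.distrib[symmetric]
    by (intro sum.cong refl) (simp add: cc_def algebra_simps)
  then have "ip v L > 0" using \<open>D > 0\<close> \<open>N v = D\<close> \<open>0 \<le> ip v cc\<close> by simp
  moreover have "0 \<le> (\<Sum>j\<in>J. - v j * L j)"
    using ip_C[OF C_f] by (intro sep) (auto simp: ip_def sum_negf)
  ultimately show False by (simp add: ip_def sum_negf)
qed

text \<open>Bounded second moments give uniform integrability: clipping h at c changes each integral
  by at most C / c, uniformly in n, and the clipped functions are bounded and continuous, so weak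
  convergence applies to them.\<close>

lemma weak_conv_integral_L2_bounded:
  fixes h :: "real \<Rightarrow> real"
  assumes "\<And>n. real_distribution (\<mu> n)" "real_distribution M" "weak_conv_m \<mu> M"
    and h: "\<And>x. isCont h x" and int: "\<And>n. integrable (\<mu> n) (\<lambda>x. (h x)\<^sup>2)"
    and bound: "\<forall>\<^sub>F n in sequentially. (\<integral>x. (h x)\<^sup>2 \<partial>\<mu> n) \<le> C"
  shows "integrable M h" "(\<lambda>n. \<integral>x. h x \<partial>\<mu> n) \<longlonglongrightarrow> (\<integral>x. h x \<partial>M)"
proof -
  interpret \<mu>: real_distribution "\<mu> n" for n by fact
  interpret M: real_distribution M by fact
  have [measurable]: "h \<in> borel_measurable borel"
    using h by (intro borel_measurable_continuous_onI continuous_at_imp_continuous_on) auto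
  have bdd: "(\<lambda>n. \<integral>x. g x \<partial>\<mu> n) \<longlonglongrightarrow> (\<integral>x. g x \<partial>M)"
    if "\<And>x. isCont g x" "\<And>x. \<bar>g x\<bar> \<le> B" for g :: "real \<Rightarrow> real" and B
    by (rule weak_conv_imp_integral_bdd_continuous_conv[OF assms(1-3)]) (use that in auto)
  \<comment> \<open>Truncated squares are bounded and continuous, so the bound C passes to M;
    letting the truncation level grow then yields integrability of the full square by monotone
    convergence.\<close>
  define T where "T c x = min ((h x)\<^sup>2) c" for c x
  have T_cont: "isCont (T c) x" for c x unfolding T_def[abs_def] by (intro continuous_intros continuous_min h)
  have T_int: "integrable M (T c)" if "c \<ge> 0" for c
    by (rule M.integrable_const_bound[of _ c]) (use that in \<open>auto simp: T_def[abs_def] \<close>)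
  have T_le: "(\<integral>x. T c x \<partial>M) \<le> C" if "c \<ge> 0" for c
  proof (rule tendsto_upperbound)
    show "(\<lambda>n. \<integral>x. T c x \<partial>\<mu> n) \<longlonglongrightarrow> (\<integral>x. T c x \<partial>M)"
      by (rule bdd[of "T c" c]) (use that in \<open>simp add: T_cont, simp add: T_def\<close>)
    have "(\<integral>x. T c x \<partial>\<mu> n) \<le> (\<integral>x. (h x)\<^sup>2 \<partial>\<mu> n)" for n
      using that by (intro integral_mono int \<mu>.integrable_const_bound[of _ c]) (auto simp: T_def[abs_def])
    then show "\<forall>\<^sub>F n in sequentially. (\<integral>x. T c x \<partial>\<mu> n) \<le> C"
      using bound by (auto elim!: eventually_mono intro: order_trans)
  qed simp
  have T_lim: "(\<lambda>k. T (real k) x) \<longlonglongrightarrow> (h x)\<^sup>2" for x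
  proof -
    obtain K :: nat where "(h x)\<^sup>2 \<le> real K" using real_arch_simple by blast
    then have "\<forall>\<^sub>F k in sequentially. T (real k) x = (h x)\<^sup>2"
      unfolding eventually_sequentially by (intro exI[of _ K]) (auto simp: T_def)
    then show ?thesis by (rule tendsto_eventually)
  qed
  have h2: "integrable M (\<lambda>x. (h x)\<^sup>2)"
  proof (rule integrable_monotone_convergence[where f="\<lambda>k. T (real k)"])
    show "\<And>k. integrable M (T (real k))" by (intro T_int) simp
    show "AE x in M. mono (\<lambda>k. T (real k) x)" by (auto simp: T_def mono_def)
    show "AE x in M. (\<lambda>k. T (real k) x) \<longlonglongrightarrow> (h x)\<^sup>2" using T_lim by simp
    have "bdd_above (range (\<lambda>k. \<integral>x. T (real k) x \<partial>M))"
      using T_le by (intro bdd_aboveI[of _ C]) auto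
    moreover have "incseq (\<lambda>k. \<integral>x. T (real k) x \<partial>M)"
      by (intro monoI integral_mono T_int) (auto simp: T_def)
    ultimately show "(\<lambda>k. \<integral>x. T (real k) x \<partial>M) \<longlonglongrightarrow> (SUP k. \<integral>x. T (real k) x \<partial>M)"
      by (intro LIMSEQ_incseq_SUP)
  qed auto
  have h2_le: "(\<integral>x. (h x)\<^sup>2 \<partial>M) \<le> C"
  proof (rule LIMSEQ_le_const2)
    show "(\<lambda>k. \<integral>x. T (real k) x \<partial>M) \<longlonglongrightarrow> (\<integral>x. (h x)\<^sup>2 \<partial>M)"
    proof (rule integral_dominated_convergence[where w="\<lambda>x. (h x)\<^sup>2"])
      show "AE x in M. (\<lambda>k. T (real k) x) \<longlonglongrightarrow> (h x)\<^sup>2" using T_lim by simp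
    qed (auto simp: T_def[abs_def] h2)
  qed (use T_le in auto)
  have abs_le: "\<bar>h x\<bar> \<le> 1 + (h x)\<^sup>2" for x
    using zero_le_power2[of "\<bar>h x\<bar> - 1"] zero_le_power2[of "h x"] unfolding power2_diff by simp
  have h_int: "integrable P h" if "real_distribution P" "integrable P (\<lambda>x. (h x)\<^sup>2)" for P
  proof -
    interpret P: real_distribution P by fact
    show ?thesis
      by (rule Bochner_Integration.integrable_bound[where f="\<lambda>x. 1 + (h x)\<^sup>2"]) (use that abs_le in auto)
  qed
  show "integrable M h" by (rule h_int) (fact assms(2), fact h2)
  define cl where "cl c x = max (- c) (min c (h x))" for c x
  have cl_cont: "isCont (cl c) x" for c x unfolding cl_def[abs_def] by (intro continuous_intros continuous_min continuous_max h)
  have cl_bdd: "\<bar>cl c x\<bar> \<le> c" if "c > 0" for c x using that by (auto simp: cl_def)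
  have cl_close: "\<bar>h x - cl c x\<bar> \<le> (h x)\<^sup>2 / c" if "c > 0" for c x
  proof (cases "\<bar>h x\<bar> \<le> c")
    case True then show ?thesis using that by (simp add: cl_def)
  next
    case False
    then have "\<bar>h x - cl c x\<bar> \<le> \<bar>h x\<bar>" using that by (auto simp: cl_def)
    also have "\<dots> * c \<le> \<bar>h x\<bar> * \<bar>h x\<bar>" using False by (intro mult_left_mono) auto
    then have "\<bar>h x\<bar> \<le> (h x)\<^sup>2 / c" using that by (simp add: field_simps power2_eq_square)
    finally show ?thesis .
  qed
  have diff: "\<bar>(\<integral>x. h x \<partial>P) - (\<integral>x. cl c x \<partial>P)\<bar> \<le> C / c"
    if P: "real_distribution P" "integrable P (\<lambda>x. (h x)\<^sup>2)" "(\<integral>x. (h x)\<^sup>2 \<partial>P) \<le> C" and c: "c > 0" for P c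
  proof -
    interpret P: real_distribution P by fact
    have [measurable]: "cl c \<in> borel_measurable borel"
      unfolding cl_def[abs_def] by measurable
    have cl_int: "integrable P (cl c)"
      by (rule P.integrable_const_bound[of _ c]) (use cl_bdd[OF c] in auto)
    have "\<bar>(\<integral>x. h x \<partial>P) - (\<integral>x. cl c x \<partial>P)\<bar> = \<bar>\<integral>x. h x - cl c x \<partial>P\<bar>"
      using h_int[OF P(1,2)] cl_int by simp
    also have "\<dots> \<le> (\<integral>x. \<bar>h x - cl c x\<bar> \<partial>P)" by (rule integral_abs_bound)
    also have "\<dots> \<le> (\<integral>x. (h x)\<^sup>2 / c \<partial>P)"
      using h_int[OF P(1,2)] cl_int P(2) by (intro integral_mono cl_close c) auto
    also have "\<dots> \<le> C / c" using P(3) c by (simp add: divide_right_mono)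
    finally show ?thesis .
  qed
  have "C \<ge> 0" using h2_le by (rule order_trans[rotated]) simp
  show "(\<lambda>n. \<integral>x. h x \<partial>\<mu> n) \<longlonglongrightarrow> (\<integral>x. h x \<partial>M)"
  proof (rule tendstoI)
    fix e :: real assume "e > 0"
    \<comment> \<open>Two clipping errors of at most e / 4 each leave e / 2 for the convergence; C +
      1 instead of C keeps c positive when C = 0.\<close>
    define c where "c = 4 * (C + 1) / e"
    have "c > 0" using \<open>e > 0\<close> \<open>C \<ge> 0\<close> by (simp add: c_def)
    have Cc: "C / c < e / 4" using \<open>e > 0\<close> \<open>C \<ge> 0\<close> by (simp add: c_def field_simps)
    have "(\<lambda>n. \<integral>x. cl c x \<partial>\<mu> n) \<longlonglongrightarrow> (\<integral>x. cl c x \<partial>M)"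
      by (rule bdd[of "cl c" c]) (rule cl_cont, rule cl_bdd[OF \<open>c > 0\<close>])
    then have "\<forall>\<^sub>F n in sequentially. dist (\<integral>x. cl c x \<partial>\<mu> n) (\<integral>x. cl c x \<partial>M) < e / 2"
      using \<open>e > 0\<close> by (intro tendstoD) auto
    with bound show "\<forall>\<^sub>F n in sequentially. dist (\<integral>x. h x \<partial>\<mu> n) (\<integral>x. h x \<partial>M) < e"
    proof eventually_elim
      case (elim n)
      have "\<bar>(\<integral>x. h x \<partial>\<mu> n) - (\<integral>x. cl c x \<partial>\<mu> n)\<bar> \<le> C / c"
        by (rule diff) (use assms(1) int elim \<open>c > 0\<close> in auto)
      moreover have "\<bar>(\<integral>x. h x \<partial>M) - (\<integral>x. cl c x \<partial>M)\<bar> \<le> C / c"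
        by (rule diff) (use assms(2) h2 h2_le \<open>c > 0\<close> in auto)
      ultimately show ?case using elim(2) Cc unfolding dist_real_def by linarith
    qed
  qed
qed

section \<open>A space-filling curve in polar coordinates\<close>

text \<open>A continuous function of period 2 that is 0 on [0, 1/3] and 1 on [2/3, 1], and so reads
  off a ternary digit.\<close>

definition bump :: "real \<Rightarrow> real" where
  "bump t = max 0 (min 1 (1 / 2 - cos (pi * t)))"

lemma bump_bounds: "0 \<le> bump t" "bump t \<le> 1"
  by (auto simp: bump_def)

lemma continuous_on_bump_scaled: "continuous_on UNIV (\<lambda>t. bump (a * t) / b)"
  unfolding bump_def divide_inverse by (intro continuous_intros)

lemma cos_shift_even: "cos (pi * (2 * real m + t)) = cos (pi * t)"
proof -
  have "pi * (2 * real m + t) = 2 * real m * pi + pi * t" by (simp add: algebra_simps)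
  then show ?thesis by (simp only: cos_add cos_2npi sin_2npi)
qed

lemma bump_shift_even: "bump (2 * real m + t) = bump t"
  by (simp add: bump_def cos_shift_even)

text \<open>Points of the Cantor set: with digits 0 and 2 only, every digit tail stays out of the
  open middle third, where \<open>bump\<close> is not constant.\<close>

definition ternary :: "(nat \<Rightarrow> bool) \<Rightarrow> real" where
  "ternary b = (suminf (\<lambda>k. 2 * of_bool (b k) / 3 ^ Suc k))"

lemma ternary_sums:
  shows summable_ternary: "summable (\<lambda>k. 2 * of_bool (b k) / 3 ^ Suc k :: real)"
    and ternary_bounds: "0 \<le> ternary b" "ternary b \<le> 1"
proof -
  have geo: "(\<lambda>k. 2 / 3 * (1 / 3) ^ k :: real) sums (2 / 3 * (1 / (1 - 1 / 3)))"
    by (intro sums_mult geometric_sums) auto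
  have le: "2 * of_bool (b k) / 3 ^ Suc k \<le> 2 / 3 * (1 / 3 :: real) ^ k" for k :: nat
    by (auto simp: power_divide field_simps)
  show s: "summable (\<lambda>k. 2 * of_bool (b k) / 3 ^ Suc k :: real)"
    by (rule summable_comparison_test'[OF sums_summable[OF geo], of 0]) (use le in auto)
  show "0 \<le> ternary b" unfolding ternary_def by (intro suminf_nonneg s) auto
  have "ternary b \<le> (suminf (\<lambda>k. 2 / 3 * (1 / 3) ^ k))"
    unfolding ternary_def by (intro suminf_le s le sums_summable[OF geo])
  then show "ternary b \<le> 1" using sums_unique[OF geo] by simp
qed

lemma ternary_step: "ternary b = (2 * of_bool (b 0) + ternary (\<lambda>k. b (Suc k))) / 3"
proof -
  have "(suminf (\<lambda>k. 2 * of_bool (b (Suc k)) / 3 ^ Suc (Suc k))) = (suminf (\<lambda>k. 2 * of_bool (b (Suc k)) / 3 ^ Suc k)) / (3::real)"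
    by (subst suminf_divide[OF summable_ternary, symmetric]) (simp add: field_simps)
  then show ?thesis
    using suminf_split_head[OF summable_ternary[of b]] by (simp add: ternary_def)
qed

text \<open>Scaling moves j digits in front of the point. All of them are even, hence so is the
  integer they form, and the period of \<open>bump\<close> removes it.\<close>

lemma ternary_scaled:
  "\<exists>m::nat. 3 ^ j * ternary b = 2 * real m + ternary (\<lambda>k. b (k + j))"
proof (induction j)
  case (Suc j)
  then obtain m :: nat where m: "3 ^ j * ternary b = 2 * real m + ternary (\<lambda>k. b (k + j))" by blast
  have "3 ^ Suc j * ternary b = 6 * real m + 3 * ternary (\<lambda>k. b (k + j))" using m by simp
  also have "\<dots> = 6 * real m + 2 * of_bool (b j) + ternary (\<lambda>k. b (k + Suc j))"
    by (subst ternary_step) simp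
  also have "\<dots> = 2 * real (3 * m + of_bool (b j)) + ternary (\<lambda>k. b (k + Suc j))" by simp
  finally show ?case by blast
qed (auto intro: exI[of _ 0])

text \<open>Periodicity discards the leading digits together with the multiple of 2 n; the first
  remaining digit decides between the outer thirds.\<close>

lemma bump_ternary: "bump (3 ^ j * (2 * real n + ternary b)) = of_bool (b j)"
proof -
  define \<rho> where "\<rho> = ternary (\<lambda>k. b (k + j))"
  obtain m :: nat where m: "3 ^ j * ternary b = 2 * real m + \<rho>"
    unfolding \<rho>_def using ternary_scaled by blast
  have "3 ^ j * (2 * real n + ternary b) = 2 * real (3 ^ j * n + m) + \<rho>"
    using m by (simp add: algebra_simps)
  then have "bump (3 ^ j * (2 * real n + ternary b)) = bump \<rho>"
    by (simp only: bump_shift_even)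
  also have "\<dots> = of_bool (b j)"
  proof -
    have \<rho>: "\<rho> = (2 * of_bool (b j) + ternary (\<lambda>k. b (Suc k + j))) / 3"
      unfolding \<rho>_def by (subst ternary_step) simp
    note bounds = ternary_bounds[of "\<lambda>k. b (Suc k + j)"]
    show ?thesis
    proof (cases "b j")
      case True
      then have "2 / 3 \<le> \<rho>" "\<rho> \<le> 1" using \<rho> bounds by auto
      then have "cos (pi * \<rho>) \<le> cos (2 * pi / 3)"
        by (intro cos_monotone_0_pi_le) (auto simp: field_simps)
      then show ?thesis using True by (simp add: bump_def cos_120)
    next
      case False
      then have "0 \<le> \<rho>" "\<rho> \<le> 1 / 3" using \<rho> bounds by auto
      then have "cos (pi / 3) \<le> cos (pi * \<rho>)"
        by (intro cos_monotone_0_pi_le) (auto simp: field_simps)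
      then show ?thesis using False by (simp add: bump_def cos_60)
    qed
  qed
  finally show ?thesis .
qed

text \<open>Greedy digits with remainders r. The threshold is non-strict, so the endpoint y = 1 is
  covered by the digits 1, 1, ... with constant remainder 1.\<close>

lemma binary_expansion:
  fixes y :: real
  assumes "0 \<le> y" "y \<le> 1"
  shows "\<exists>b :: nat \<Rightarrow> bool. (\<lambda>k. of_bool (b k) / 2 ^ Suc k) sums y"
proof -
  define r where "r = rec_nat y (\<lambda>_ r. 2 * r - of_bool (1 / 2 \<le> r))"
  define b where "b k \<longleftrightarrow> 1 / 2 \<le> r k" for k
  have r_Suc: "r (Suc k) = 2 * r k - of_bool (b k)" and r_0: "r 0 = y" for k
    by (simp_all add: r_def b_def)
  have bounds: "0 \<le> r k \<and> r k \<le> 1" for k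
    by (induction k) (use assms in \<open>auto simp: r_0 r_Suc b_def\<close>)
  have partial: "(\<Sum>k<n. of_bool (b k) / 2 ^ Suc k) = y - r n / 2 ^ n" for n
    by (induction n) (auto simp: r_0 r_Suc field_simps)
  have "(\<lambda>n. r n / 2 ^ n) \<longlonglongrightarrow> 0"
  proof (rule Lim_null_comparison)
    show "\<forall>\<^sub>F n in sequentially. norm (r n / 2 ^ n) \<le> (1 / 2) ^ n"
      using bounds by (auto simp: power_divide divide_right_mono)
  qed (intro LIMSEQ_realpow_zero, auto)
  then have "(\<lambda>n. y - r n / 2 ^ n) \<longlonglongrightarrow> y - 0"
    by (intro tendsto_intros)
  then show ?thesis unfolding sums_def partial[symmetric] by auto
qed

text \<open>A curve in the style of Schoenberg: the ternary digits of the parameter are dealt out to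
  the binary digits of the coordinates.\<close>

lemma space_filling_curve:
  obtains c :: "real \<Rightarrow> 'c::finite \<Rightarrow> real" where
    "\<And>i. continuous_on UNIV (\<lambda>t. c t i)" "\<And>t i. 0 \<le> c t i" "\<And>t i. c t i \<le> 1"
    "\<And>y n. (\<And>i. 0 \<le> y i \<and> y i \<le> 1) \<Longrightarrow> \<exists>\<tau>\<in>{0..1}. c (2 * real n + \<tau>) = y"
proof -
  define N where "N = CARD('c)"
  have "N > 0" by (simp add: N_def)
  obtain e :: "'c \<Rightarrow> nat" where e: "bij_betw e UNIV {0..<N}"
    using ex_bij_betw_finite_nat[OF finite] N_def by blast
  then have e_less: "e i < N" for i by (auto dest!: bij_betwE)
  define c where "c t i = (suminf (\<lambda>k. bump (3 ^ (N * k + e i) * t) / 2 ^ Suc k))" for t i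
  have geo: "(\<lambda>k. 1 / 2 * (1 / 2) ^ k :: real) sums (1 / 2 * (1 / (1 - 1 / 2)))"
    by (intro sums_mult geometric_sums) auto
  have le: "bump s / 2 ^ Suc k \<le> 1 / 2 * (1 / 2) ^ k" for k s
    using bump_bounds[of s] by (simp add: power_divide field_simps)
  have summable: "summable (\<lambda>k. bump (f k) / 2 ^ Suc k)" for f
    by (rule summable_comparison_test'[OF sums_summable[OF geo], of 0]) (use le bump_bounds in auto)
  show thesis
  proof (rule that[of c])
    fix i t
    show "0 \<le> c t i"
      unfolding c_def by (intro suminf_nonneg summable divide_nonneg_nonneg bump_bounds) auto
    have "c t i \<le> (suminf (\<lambda>k. 1 / 2 * (1 / 2) ^ k))"
      unfolding c_def by (intro suminf_le summable le sums_summable[OF geo])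
    then show "c t i \<le> 1" using sums_unique[OF geo] by simp
    have ul: "uniform_limit UNIV (\<lambda>n t. \<Sum>k<n. bump (3 ^ (N * k + e i) * t) / 2 ^ Suc k) (\<lambda>t. c t i) sequentially"
      unfolding c_def
      by (rule Weierstrass_m_test[OF _ sums_summable[OF geo]]) (use le bump_bounds in auto)
    have "continuous_on UNIV (\<lambda>t. \<Sum>k<n. bump (3 ^ (N * k + e i) * t) / 2 ^ Suc k)" for n
      by (rule continuous_on_sum) (rule continuous_on_bump_scaled)
    then show "continuous_on UNIV (\<lambda>t. c t i)"
      by (rule uniform_limit_theorem[OF always_eventually[OF allI] ul trivial_limit_sequentially])
  next
    fix y :: "'c \<Rightarrow> real" and n :: nat
    assume y: "\<And>i. 0 \<le> y i \<and> y i \<le> 1"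
    define \<beta> :: "'c \<Rightarrow> nat \<Rightarrow> bool" where
      "\<beta> i = (SOME b. (\<lambda>k. of_bool (b k) / 2 ^ Suc k) sums y i)" for i
    have \<beta>: "(\<lambda>k. of_bool (\<beta> i k) / 2 ^ Suc k) sums y i" for i
      unfolding \<beta>_def using y by (intro someI_ex[OF binary_expansion]) auto
    \<comment> \<open>Undoes the interleaving: position j belongs to the coordinate numbered
      \<open>j mod N\<close>, at its binary place \<open>j div N\<close>.\<close>
    define b where "b j = \<beta> (the_inv_into UNIV e (j mod N)) (j div N)" for j
    have "b (N * k + e i) = \<beta> i k" for i k
      using e_less[of i] the_inv_into_f_f[OF bij_betw_imp_inj_on[OF e], of i] \<open>N > 0\<close>
      by (simp add: b_def)
    then have "c (2 * real n + ternary b) i = y i" for i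
      unfolding c_def bump_ternary using sums_unique[OF \<beta>[of i]] by simp
    then show "\<exists>\<tau>\<in>{0..1}. c (2 * real n + \<tau>) = y"
      using ternary_bounds by (intro bexI[of _ "ternary b"]) auto
  qed
qed

text \<open>The bound on the parameter of a preimage turns moment bounds into tightness on the line.\<close>

lemma polar_curve:
  obtains \<Theta> :: "real \<Rightarrow> real^'n" and R :: "real \<Rightarrow> real" where
    "continuous_on UNIV \<Theta>" "continuous_on UNIV R" "\<And>t i. \<bar>\<Theta> t $ i\<bar> \<le> 1"
    "\<And>\<theta> r. (\<And>i. \<bar>\<theta> $ i\<bar> \<le> 1) \<Longrightarrow> 0 \<le> r \<Longrightarrow> \<exists>t. \<Theta> t = \<theta> \<and> R t = r \<and> 0 \<le> t \<and> t \<le> 2 * r + 3"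
proof -
  obtain c :: "real \<Rightarrow> 'n option \<Rightarrow> real" where
    cont: "\<And>i. continuous_on UNIV (\<lambda>t. c t i)" and bounds: "\<And>t i. 0 \<le> c t i" "\<And>t i. c t i \<le> 1"
    and onto: "\<And>y n. (\<And>i. 0 \<le> y i \<and> y i \<le> 1) \<Longrightarrow> \<exists>\<tau>\<in>{0..1}. c (2 * real n + \<tau>) = y"
    by (rule space_filling_curve) blast
  \<comment> \<open>The subtracted term is the distance of t to the nearest even integer. Hence h is
    continuous, stays at 2 n on [2 n, 2 n + 1] and climbs to the next even integer on the following
    interval.\<close>
  define h where "h t = t - arccos (cos (pi * t)) / pi" for t
  have h: "h (2 * real n + \<tau>) = 2 * real n" if "\<tau> \<in> {0..1}" for n \<tau>
  proof -
    have "arccos (cos (pi * \<tau>)) = pi * \<tau>"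
      using that by (intro arccos_cos) (auto simp: mult_le_cancel_left1)
    then show ?thesis by (simp add: h_def cos_shift_even)
  qed
  define \<Theta> :: "real \<Rightarrow> real^'n" where "\<Theta> t = (\<chi> i. 2 * c t (Some i) - 1)" for t
  define R where "R t = h t * c t None" for t
  show thesis
  proof (rule that[of \<Theta> R])
    show "continuous_on UNIV \<Theta>"
      unfolding \<Theta>_def by (intro continuous_intros cont)
    have "continuous_on UNIV h"
      unfolding h_def by (intro continuous_intros) auto
    then show "continuous_on UNIV R"
      unfolding R_def by (intro continuous_intros cont)
    show "\<bar>\<Theta> t $ i\<bar> \<le> 1" for t i
      using bounds[of t "Some i"] by (simp add: \<Theta>_def)
    fix \<theta> :: "real^'n" and r :: real
    assume \<theta>: "\<And>i. \<bar>\<theta> $ i\<bar> \<le> 1" and r: "0 \<le> r"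
    \<comment> \<open>The radius on the plateau of height 2 n is 2 n times a coordinate in [0, 1],
      so r \<le> n suffices; n \<ge> 1 permits the division, and n \<le> r + 1 bounds the parameter
      by 2 r + 3.\<close>
    define n where "n = Suc (nat \<lfloor>r\<rfloor>)"
    have n: "r \<le> real n" "real n \<le> r + 1" "real n \<ge> 1" using r by (auto simp: n_def) linarith+
    define y where "y i = (case i of Some j \<Rightarrow> (\<theta> $ j + 1) / 2 | None \<Rightarrow> r / (2 * real n))" for i
    have "0 \<le> y i \<and> y i \<le> 1" for i
      using \<theta> r n by (auto simp: y_def abs_le_iff field_simps split: option.split) (smt (verit))+
    then obtain \<tau> where \<tau>: "\<tau> \<in> {0..1}" "c (2 * real n + \<tau>) = y"
      using onto by blast
    have "\<Theta> (2 * real n + \<tau>) = \<theta>"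
      using \<tau>(2) by (simp add: \<Theta>_def y_def vec_eq_iff field_simps)
    moreover have "R (2 * real n + \<tau>) = r"
      using \<tau> h[OF \<tau>(1), of n] n by (simp add: R_def y_def)
    ultimately show "\<exists>t. \<Theta> t = \<theta> \<and> R t = r \<and> 0 \<le> t \<and> t \<le> 2 * r + 3"
      using \<tau>(1) n by (intro exI[of _ "2 * real n + \<tau>"]) auto
  qed
qed

section \<open>From the positive minimum principle to the Levy triple\<close>

text \<open>The coefficient of z^b in ((z + s) - s)^a, expanded first in powers of z + s.\<close>

lemma binomial_inversion:
  fixes s :: real
  shows "(\<Sum>k\<le>a. real (a choose k) * (- s) ^ (a - k) * (real (k choose b) * s ^ (k - b))) = of_bool (a = b)"
proof (cases "b \<le> a")
  case False
  then show ?thesis by (auto intro!: sum.neutral)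
next
  case True
  have "(\<Sum>k\<le>a. real (a choose k) * (- s) ^ (a - k) * (real (k choose b) * s ^ (k - b))) =
      (\<Sum>k\<in>{b..a}. real (a choose k) * (- s) ^ (a - k) * (real (k choose b) * s ^ (k - b)))"
    by (intro sum.mono_neutral_right) auto
  also have "\<dots> = (\<Sum>j\<le>a - b. real (a choose b) * (real (a - b choose j) * s ^ j * (- s) ^ (a - b - j)))"
  proof (rule sum.reindex_bij_witness[of _ "\<lambda>j. j + b" "\<lambda>k. k - b"])
    fix k assume "k \<in> {b..a}"
    then have "(a choose k) * (k choose b) = (a choose b) * (a - b choose (k - b))"
      using choose_mult[of b k a] by simp
    then have *: "real (a choose k) * real (k choose b) = real (a choose b) * real (a - b choose (k - b))"
      by (metis of_nat_mult)
    have "a - b - (k - b) = a - k" using \<open>k \<in> {b..a}\<close> by simp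
    then have "real (a choose b) * (real (a - b choose (k - b)) * s ^ (k - b) * (- s) ^ (a - b - (k - b))) =
        (real (a choose b) * real (a - b choose (k - b))) * (s ^ (k - b) * (- s) ^ (a - k))" by simp
    also have "\<dots> = real (a choose k) * (- s) ^ (a - k) * (real (k choose b) * s ^ (k - b))"
      unfolding *[symmetric] by (simp only: mult_ac)
    finally show "real (a choose b) * (real (a - b choose (k - b)) * s ^ (k - b) * (- s) ^ (a - b - (k - b))) =
        real (a choose k) * (- s) ^ (a - k) * (real (k choose b) * s ^ (k - b))" .
  qed (use True in auto)
  also have "\<dots> = real (a choose b) * (s + - s) ^ (a - b)"
    by (simp only: binomial_ring sum_distrib_left)
  also have "\<dots> = of_bool (a = b)" using True by (auto simp: power_0_left)
  finally show ?thesis .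
qed

text \<open>The monomials centred at y are dual to the Taylor coefficients there, so any finite
  family of Taylor coefficients can be prescribed.\<close>

lemma ex_shifted_monomial:
  "\<exists>Q. (\<forall>\<beta>. taylor Q y \<beta> = of_bool (\<alpha> = \<beta>)) \<and> (\<forall>x. poly_eval Q x = mono_eval \<alpha> (x - y))"
proof -
  define c where "c \<gamma> = (\<Prod>i\<in>UNIV. real (\<alpha> i choose \<gamma> i) * (- y $ i) ^ (\<alpha> i - \<gamma> i))" for \<gamma>
  define Q where "Q = (\<Sum>\<gamma> | \<forall>i. \<gamma> i \<le> \<alpha> i. Poly_Mapping.single \<gamma> (c \<gamma>))"
  have "taylor Q y \<beta> = of_bool (\<alpha> = \<beta>)" for \<beta>
  proof -
    have "taylor Q y \<beta> = (\<Sum>\<gamma> | \<forall>i. \<gamma> i \<le> \<alpha> i. \<Prod>i\<in>UNIV. real (\<alpha> i choose \<gamma> i) * (- y $ i) ^ (\<alpha> i - \<gamma> i)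
        * (real (\<gamma> i choose \<beta> i) * (y $ i) ^ (\<gamma> i - \<beta> i)))"
      by (simp add: Q_def taylor_sum taylor_single c_def prod.distrib)
    also have "\<dots> = (\<Prod>i\<in>UNIV. \<Sum>k\<le>\<alpha> i. real (\<alpha> i choose k) * (- y $ i) ^ (\<alpha> i - k)
        * (real (k choose \<beta> i) * (y $ i) ^ (k - \<beta> i)))"
      by (rule prod_sum_below[symmetric])
    also have "\<dots> = (\<Prod>i\<in>UNIV. of_bool (\<alpha> i = \<beta> i))"
      by (simp only: binomial_inversion)
    also have "\<dots> = of_bool (\<alpha> = \<beta>)"
      by (auto simp: fun_eq_iff prod_eq_1_iff)
    finally show ?thesis .
  qed
  moreover have "poly_eval Q x = mono_eval \<alpha> (x - y)" for x
  proof -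
    have "poly_eval Q x = (\<Sum>\<gamma> | \<forall>i. \<gamma> i \<le> \<alpha> i. \<Prod>i\<in>UNIV.
        real (\<alpha> i choose \<gamma> i) * (x $ i) ^ \<gamma> i * (- y $ i) ^ (\<alpha> i - \<gamma> i))"
      by (simp add: Q_def poly_eval_sum c_def mono_eval_def mult_ac flip: prod.distrib)
    also have "\<dots> = (\<Prod>i\<in>UNIV. \<Sum>k\<le>\<alpha> i. real (\<alpha> i choose k) * (x $ i) ^ k * (- y $ i) ^ (\<alpha> i - k))"
      by (rule prod_sum_below[symmetric])
    also have "\<dots> = (\<Prod>i\<in>UNIV. (x $ i + - y $ i) ^ \<alpha> i)"
      by (simp only: binomial_ring)
    finally show ?thesis by (simp add: mono_eval_def)
  qed
  ultimately show ?thesis by blast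
qed

section \<open>The positive functional given by the coefficients at y\<close>

lemma mono_eval_at_0: "0 < mdeg \<alpha> \<Longrightarrow> mono_eval \<alpha> 0 = 0"
  using mono_eval_scaleR[of \<alpha> 0 0] by (auto simp: power_0_left)

text \<open>The polynomial with Taylor coefficients v at y vanishes there because J lacks the index
  0, and A evaluates it at y to the pairing of v with the coefficients.\<close>

lemma pos_min_functional:
  fixes a :: "('n::finite \<Rightarrow> nat) \<Rightarrow> 'n mpoly"
  assumes pm: "pos_min a y" and "finite J" and J: "\<And>\<alpha>. \<alpha> \<in> J \<Longrightarrow> 0 < mdeg \<alpha>"
    and nonneg: "\<And>z. 0 \<le> (\<Sum>\<alpha>\<in>J. v \<alpha> * mono_eval \<alpha> z)"
  shows "0 \<le> (\<Sum>\<alpha>\<in>J. v \<alpha> * poly_eval (a \<alpha>) y)"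
proof -
  obtain q where q: "\<And>\<alpha> \<beta>. taylor (q \<alpha>) y \<beta> = of_bool (\<alpha> = \<beta>)" "\<And>\<alpha> x. poly_eval (q \<alpha>) x = mono_eval \<alpha> (x - y)"
    using ex_shifted_monomial[of y] by metis
  define Q where "Q = (\<Sum>\<alpha>\<in>J. scalem (v \<alpha>) (q \<alpha>))"
  have taylor_Q: "taylor Q y \<beta> = (if \<beta> \<in> J then v \<beta> else 0)" for \<beta>
    using \<open>finite J\<close> by (simp add: Q_def taylor_sum taylor_scalem q of_bool_def if_distrib[of "\<lambda>x. _ * x"] sum.delta cong: if_cong)
  have eval_Q: "poly_eval Q x = (\<Sum>\<alpha>\<in>J. v \<alpha> * mono_eval \<alpha> (x - y))" for x
    by (simp add: Q_def poly_eval_sum poly_eval_scalem q)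
  have "Q \<in> Pos" using nonneg by (simp add: Pos_def eval_Q)
  moreover have "poly_eval Q y = 0" using J by (simp add: eval_Q mono_eval_at_0)
  ultimately have "0 \<le> poly_eval (opA a Q) y" using pm by (auto simp: pos_min_def)
  also have "\<dots> = (\<Sum>\<alpha>\<in>J. v \<alpha> * poly_eval (a \<alpha>) y)"
  proof -
    obtain d where "deg_le Q d" using ex_deg_le by blast
    then have d: "deg_le Q (d + (\<Sum>\<alpha>\<in>J. mdeg \<alpha>))" by (rule deg_le_mono) simp
    have "J \<subseteq> multis (d + (\<Sum>\<alpha>\<in>J. mdeg \<alpha>))"
      using \<open>finite J\<close> by (auto simp: multis_def intro!: trans_le_add2 member_le_sum)
    then show ?thesis
      unfolding poly_eval_opA[OF d] taylor_Q
      by (intro sum.mono_neutral_cong_right) auto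
  qed
  finally show ?thesis .
qed

text \<open>The additional atom at \<open>s z\<close> keeps the total mass away from zero.\<close>

lemma normalized_atoms:
  fixes s :: "'x \<Rightarrow> real" and w :: "'x \<Rightarrow> real"
  assumes "finite S" "\<And>x. 0 \<le> w x"
  obtains M where "real_distribution M"
    "\<And>h :: real \<Rightarrow> real. h \<in> borel_measurable borel \<Longrightarrow> integrable M h"
    "\<And>h :: real \<Rightarrow> real. h \<in> borel_measurable borel \<Longrightarrow>
      (\<integral>t. h t \<partial>M) = ((\<Sum>x\<in>S. w x * h (s x)) + h (s z)) / ((\<Sum>x\<in>S. w x) + (1::real))"
proof -
  define W where "W = (\<Sum>x\<in>S. w x) + 1"
  have "W > 0" unfolding W_def using assms by (intro add_nonneg_pos sum_nonneg) auto
  \<comment> \<open>The separate index None keeps the additional atom distinct even if z belongs to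
    S.\<close>
  define S' where "S' = insert None (Some ` S)"
  define p where "p k = (case k of None \<Rightarrow> 1 / W | Some x \<Rightarrow> w x / W)" for k
  define s' where "s' k = (case k of None \<Rightarrow> s z | Some x \<Rightarrow> s x)" for k
  have "finite S'" using assms by (simp add: S'_def)
  have p_nonneg: "0 \<le> p k" for k using assms \<open>W > 0\<close> by (auto simp: p_def split: option.split)
  have sum_S': "(\<Sum>k\<in>S'. p k * g (s' k)) = ((\<Sum>x\<in>S. w x * g (s x)) + g (s z)) / W" for g
  proof -
    have "(\<Sum>k\<in>S'. p k * g (s' k)) = p None * g (s' None) + (\<Sum>x\<in>S. p (Some x) * g (s' (Some x)))"
      using assms(1) by (simp add: S'_def sum.reindex)
    then show ?thesis
      by (simp add: p_def s'_def add_divide_distrib sum_divide_distrib)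
  qed
  have [measurable]: "s' \<in> measurable (point_measure S' p) borel"
    by (simp add: point_measure_def)
  interpret P: prob_space "point_measure S' p"
    using sum_S'[of "\<lambda>_. 1"] \<open>W > 0\<close>
    by (intro prob_space_point_measure \<open>finite S'\<close>) (simp_all add: W_def sum_ennreal p_nonneg)
  show thesis
  proof (rule that[of "distr (point_measure S' p) borel s'"])
    show "real_distribution (distr (point_measure S' p) borel s')" by (rule P.real_distribution_distr) measurable
    fix h :: "real \<Rightarrow> real" assume [measurable]: "h \<in> borel_measurable borel"
    show "integrable (distr (point_measure S' p) borel s') h"
      by (subst integrable_distr_eq) (auto intro: integrable_point_measure_finite \<open>finite S'\<close>)
    show "(\<integral>t. h t \<partial>distr (point_measure S' p) borel s') = ((\<Sum>x\<in>S. w x * h (s x)) + h (s z)) / ((\<Sum>x\<in>S. w x) + 1)"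
      by (subst integral_distr)
         (simp_all add: lebesgue_integral_point_measure_finite \<open>finite S'\<close> p_nonneg sum_S' flip: W_def)
  qed
qed

text \<open>For even m the right-hand side is a sum of monomials, so that powers of the norm are
  bounded by moments.\<close>

lemma norm_power_le:
  fixes x :: "real^'n"
  shows "norm x ^ m \<le> real CARD('n) ^ m * (\<Sum>i\<in>UNIV. \<bar>x $ i\<bar> ^ m)"
proof -
  define B where "B = Max (range (\<lambda>i. \<bar>x $ i\<bar>))"
  have B: "\<bar>x $ i\<bar> \<le> B" for i unfolding B_def by (intro Max_ge) auto
  have "B \<in> range (\<lambda>i. \<bar>x $ i\<bar>)" unfolding B_def by (intro Max_in) auto
  then obtain i where i: "B = \<bar>x $ i\<bar>" by auto
  have "norm x \<le> (\<Sum>i\<in>UNIV. \<bar>x $ i\<bar>)" by (rule norm_le_l1_cart)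
  also have "\<dots> \<le> (\<Sum>i\<in>(UNIV::'n set). B)" using B by (intro sum_mono)
  finally have "norm x ^ m \<le> (real CARD('n) * B) ^ m" by (intro power_mono) auto
  also have "\<dots> = real CARD('n) ^ m * \<bar>x $ i\<bar> ^ m" by (simp add: power_mult_distrib i)
  also have "\<dots> \<le> real CARD('n) ^ m * (\<Sum>i\<in>UNIV. \<bar>x $ i\<bar> ^ m)"
    by (intro mult_left_mono member_le_sum) auto
  finally show ?thesis .
qed

lemma norm_square_eq: "(norm x)\<^sup>2 = (\<Sum>i\<in>UNIV. mono_eval (unitv i + unitv i) x)" for x :: "real^'n"
  by (simp add: power2_norm_eq_inner inner_vec_def mono_eval_add)

lemma mono_eval_single_power: "mono_eval (\<lambda>j. if j = i then m else 0) x = (x $ i) ^ m"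
  by (simp add: mono_eval_def if_distrib[of "\<lambda>k. _ ^ k"] prod.delta cong: if_cong)

lemma mdeg_single_power: "mdeg (\<lambda>j. if j = i then m else 0) = m"
  by (simp add: mdeg_def sum.delta)

text \<open>An atom of mass \<open>w\<close> at \<open>x\<close> is replaced by one of mass \<open>w |x|\<^sup>2\<close> in polar coordinates
  \<open>(x / |x|, |x|)\<close>. In the limit mass may accumulate at radius zero, with a direction \<open>\<Theta>\<close>: this
  part becomes the Gaussian covariance.\<close>

lemma moment_limit:
  fixes l :: "('n::finite \<Rightarrow> nat) \<Rightarrow> real"
  assumes pos: "\<And>J v. finite J \<Longrightarrow> (\<And>\<alpha>. \<alpha> \<in> J \<Longrightarrow> 2 \<le> mdeg \<alpha>) \<Longrightarrow>
      (\<And>z :: real^'n. 0 \<le> (\<Sum>\<alpha>\<in>J. v \<alpha> * mono_eval \<alpha> z)) \<Longrightarrow> 0 \<le> (\<Sum>\<alpha>\<in>J. v \<alpha> * l \<alpha>)"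
  obtains M :: "real measure" and \<Theta> :: "real \<Rightarrow> real^'n" and R W where
    "real_distribution M" "continuous_on UNIV \<Theta>" "continuous_on UNIV R" "(0::real) < W"
    "\<And>\<alpha>. 2 \<le> mdeg \<alpha> \<Longrightarrow> integrable M (\<lambda>t. R t ^ (mdeg \<alpha> - 2) * mono_eval \<alpha> (\<Theta> t))"
    "\<And>\<alpha>. 2 \<le> mdeg \<alpha> \<Longrightarrow> l \<alpha> = W * (\<integral>t. R t ^ (mdeg \<alpha> - 2) * mono_eval \<alpha> (\<Theta> t) \<partial>M)"
proof -
  obtain \<Theta> :: "real \<Rightarrow> real^'n" and R :: "real \<Rightarrow> real" where
    cont: "continuous_on UNIV \<Theta>" "continuous_on UNIV R" and \<Theta>_le: "\<And>t i. \<bar>\<Theta> t $ i\<bar> \<le> 1"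
    and onto: "\<And>\<theta> r. (\<And>i. \<bar>\<theta> $ i\<bar> \<le> 1) \<Longrightarrow> 0 \<le> r \<Longrightarrow> \<exists>t. \<Theta> t = \<theta> \<and> R t = r \<and> 0 \<le> t \<and> t \<le> 2 * r + 3"
    by (rule polar_curve) blast
  have [measurable]: "R \<in> borel_measurable borel" "\<Theta> \<in> borel_measurable borel"
    using cont by (auto intro: borel_measurable_continuous_onI)
  have "\<exists>t. \<Theta> t = sgn x \<and> R t = norm x \<and> 0 \<le> t \<and> t \<le> 2 * norm x + 3" for x
    by (rule onto) (auto intro!: order_trans[OF component_le_norm_cart] simp: norm_sgn)
  then obtain s where s: "\<And>x. \<Theta> (s x) = sgn x" "\<And>x. R (s x) = norm x" "\<And>x. 0 \<le> s x" "\<And>x. s x \<le> 2 * norm x + 3"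
    by metis
  \<comment> \<open>Degree N + 4 rather than N: even stage 0 then controls the moments of degree 4,
    so the second moment bound behind tightness holds at every stage.\<close>
  have "\<exists>S w. finite S \<and> (\<forall>x. 0 \<le> w x) \<and> (\<forall>\<alpha>. 2 \<le> mdeg \<alpha> \<longrightarrow> mdeg \<alpha> \<le> N + 4 \<longrightarrow>
      \<bar>(\<Sum>x\<in>S. w x * mono_eval \<alpha> (x :: real^'n)) - l \<alpha>\<bar> < 1 / real (Suc N))" for N
  proof -
    define J where "J = {\<alpha> \<in> multis (N + 4) :: ('n \<Rightarrow> nat) set. 2 \<le> mdeg \<alpha>}"
    have "finite J" by (simp add: J_def)
    have J: "2 \<le> mdeg \<alpha>" if "\<alpha> \<in> J" for \<alpha> using that by (simp add: J_def)
    show ?thesis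
      by (rule cone_approximation[OF \<open>finite J\<close>, of "1 / real (Suc N)" "\<lambda>x \<alpha>. mono_eval \<alpha> x" l])
        (use pos[OF \<open>finite J\<close> J] in \<open>auto simp: J_def multis_def\<close>)
  qed
  then obtain S w where fin: "\<And>N. finite (S N)" and w: "\<And>N x. 0 \<le> w N x"
    and approx: "\<And>N \<alpha>. 2 \<le> mdeg \<alpha> \<Longrightarrow> mdeg \<alpha> \<le> N + 4 \<Longrightarrow>
      \<bar>(\<Sum>x\<in>S N. w N x * mono_eval \<alpha> x) - l \<alpha>\<bar> < 1 / real (Suc N)"
    by metis
  define u where "u N x = w N x * (norm x)\<^sup>2" for N x
  have u: "0 \<le> u N x" for N x using w by (simp add: u_def)
  define WN where "WN N = (\<Sum>x\<in>S N. u N x) + 1" for N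
  have WN: "1 \<le> WN N" for N unfolding WN_def using u by (simp add: sum_nonneg)
  have "\<exists>M. real_distribution M \<and> (\<forall>h\<in>borel_measurable borel. integrable M h \<and>
      (\<integral>t. h t \<partial>M) = ((\<Sum>x\<in>S N. u N x * h (s x)) + h (s 0)) / WN N)" for N
    unfolding WN_def
    by (rule normalized_atoms[where s=s and z=0 and w="u N", OF fin[of N] u[of N]]) blast
  then obtain M where M: "\<And>N. real_distribution (M N)"
    and M_int: "\<And>N (h::real \<Rightarrow> real). h \<in> borel_measurable borel \<Longrightarrow> integrable (M N) h"
    and M_eq: "\<And>N h. h \<in> borel_measurable borel \<Longrightarrow>
      (\<integral>t. h t \<partial>M N) = ((\<Sum>x\<in>S N. u N x * h (s x)) + h (s 0)) / WN N"
    by metis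
  define F where "F \<alpha> t = R t ^ (mdeg \<alpha> - 2) * mono_eval \<alpha> (\<Theta> t)" for \<alpha> t
  have F_cont: "continuous_on UNIV (F \<alpha>)" for \<alpha>
    unfolding F_def by (intro continuous_intros cont)
  have [measurable]: "F \<alpha> \<in> borel_measurable borel" for \<alpha>
    using F_cont by (rule borel_measurable_continuous_onI)
  have F_s: "u N x * F \<alpha> (s x) = w N x * mono_eval \<alpha> x" if "2 \<le> mdeg \<alpha>" for N \<alpha> x
  proof -
    have "mono_eval \<alpha> x = mono_eval \<alpha> (norm x *\<^sub>R sgn x)"
      by (cases "x = 0") (auto simp: sgn_div_norm)
    also have "\<dots> = norm x ^ (2 + (mdeg \<alpha> - 2)) * mono_eval \<alpha> (sgn x)"
    proof -
      have "mdeg \<alpha> = 2 + (mdeg \<alpha> - 2)" using that by simp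
      then show ?thesis by (metis mono_eval_scaleR)
    qed
    finally show ?thesis
      by (simp only: F_def u_def s power_add mult_ac)
  qed
  \<comment> \<open>The additional atom has direction \<open>sgn 0 = 0\<close> and adds nothing to a
    moment, not even in degree 2, where the power of R equals 1.\<close>
  have F_0: "F \<alpha> (s 0) = 0" if "2 \<le> mdeg \<alpha>" for \<alpha>
    using that by (simp add: F_def s mono_eval_at_0)
  have F_int: "(\<integral>t. F \<alpha> t \<partial>M N) = (\<Sum>x\<in>S N. w N x * mono_eval \<alpha> x) / WN N" if "2 \<le> mdeg \<alpha>" for \<alpha> N
    by (simp add: M_eq F_s[OF that] F_0[OF that])
  have lim_l: "(\<lambda>N. \<Sum>x\<in>S N. w N x * mono_eval \<alpha> x) \<longlonglongrightarrow> l \<alpha>" if "2 \<le> mdeg \<alpha>" for \<alpha>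
  proof (rule Lim_transform[OF tendsto_const Lim_null_comparison])
    show "\<forall>\<^sub>F N in sequentially. norm ((\<Sum>x\<in>S N. w N x * mono_eval \<alpha> x) - l \<alpha>) \<le> 1 / real (Suc N)"
      unfolding eventually_sequentially
      using approx[OF that] by (intro exI[of _ "mdeg \<alpha>"]) (auto intro!: less_imp_le)
  qed (rule LIMSEQ_Suc[OF lim_1_over_n])
  have deg2: "2 \<le> mdeg (unitv i + unitv i)" for i :: 'n by (simp add: mdeg_add)
  \<comment> \<open>The limit of the total masses: |x|^2 is the sum of the squared coordinates, and
    1 is the additional atom.\<close>
  define W where "W = (\<Sum>i\<in>UNIV. l (unitv i + unitv i)) + 1"
  have WN_eq: "WN N = (\<Sum>i\<in>UNIV. \<Sum>x\<in>S N. w N x * mono_eval (unitv i + unitv i) x) + 1" for N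
    by (subst sum.swap) (simp add: WN_def u_def norm_square_eq sum_distrib_left)
  have W_lim: "WN \<longlonglongrightarrow> W"
    unfolding WN_eq[abs_def] W_def by (intro tendsto_intros lim_l deg2)
  have "1 \<le> W" using W_lim WN by (intro LIMSEQ_le_const) auto
  have F_lim: "(\<lambda>N. \<integral>t. F \<alpha> t \<partial>M N) \<longlonglongrightarrow> l \<alpha> / W" if "2 \<le> mdeg \<alpha>" for \<alpha>
    unfolding F_int[OF that] using \<open>1 \<le> W\<close> by (intro tendsto_intros lim_l that W_lim) simp
  \<comment> \<open>The weight |x|^2 raises R^(2 k) to a moment of degree 2 k + 2; evenness makes it
    a sum of monomials up to a constant.\<close>
  have "\<exists>C. \<forall>N. 2 * k + 2 \<le> N + 4 \<longrightarrow> (\<integral>t. R t ^ (2 * k) \<partial>M N) \<le> C" for k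
  proof (intro exI allI impI)
    fix N assume N: "2 * k + 2 \<le> N + 4"
    define m where "m = 2 * k + 2"
    define c where "c = real CARD('n) ^ m"
    let ?\<alpha> = "\<lambda>i j. if j = i then m else 0"
    have "(\<Sum>x\<in>S N. u N x * R (s x) ^ (2 * k)) = (\<Sum>x\<in>S N. w N x * norm x ^ m)"
      by (simp add: u_def s m_def power_add power2_eq_square mult_ac)
    also have "\<dots> \<le> (\<Sum>x\<in>S N. w N x * (c * (\<Sum>i\<in>UNIV. \<bar>x $ i\<bar> ^ m)))"
      unfolding c_def by (intro sum_mono mult_left_mono norm_power_le w)
    also have "\<dots> = (\<Sum>x\<in>S N. \<Sum>i\<in>UNIV. c * (w N x * mono_eval (?\<alpha> i) x))"
    proof -
      have "\<bar>x $ i\<bar> ^ m = mono_eval (?\<alpha> i) x" for x :: "real^'n" and i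
        by (simp add: mono_eval_single_power m_def power_even_abs)
      then show ?thesis by (simp only: sum_distrib_left mult_ac)
    qed
    also have "\<dots> = c * (\<Sum>i\<in>UNIV. \<Sum>x\<in>S N. w N x * mono_eval (?\<alpha> i) x)"
      by (subst sum.swap) (simp add: sum_distrib_left)
    also have "\<dots> \<le> c * (\<Sum>i\<in>UNIV. l (?\<alpha> i) + 1)"
    proof (intro mult_left_mono sum_mono)
      fix i
      have "\<bar>(\<Sum>x\<in>S N. w N x * mono_eval (?\<alpha> i) x) - l (?\<alpha> i)\<bar> < 1 / real (Suc N)"
        using N by (intro approx) (simp_all only: mdeg_single_power m_def)
      also have "\<dots> \<le> 1" by simp
      finally show "(\<Sum>x\<in>S N. w N x * mono_eval (?\<alpha> i) x) \<le> l (?\<alpha> i) + 1" by linarith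
    qed (simp add: c_def)
    finally have *: "(\<Sum>x\<in>S N. u N x * R (s x) ^ (2 * k)) \<le> c * (\<Sum>i\<in>UNIV. l (?\<alpha> i) + 1)" .
    have nn: "0 \<le> (\<Sum>x\<in>S N. u N x * R (s x) ^ (2 * k)) + R (s 0) ^ (2 * k)"
      using u by (intro add_nonneg_nonneg sum_nonneg mult_nonneg_nonneg) (auto simp: s)
    have "(\<integral>t. R t ^ (2 * k) \<partial>M N) = ((\<Sum>x\<in>S N. u N x * R (s x) ^ (2 * k)) + R (s 0) ^ (2 * k)) / WN N"
      by (rule M_eq) measurable
    also have "\<dots> \<le> ((\<Sum>x\<in>S N. u N x * R (s x) ^ (2 * k)) + R (s 0) ^ (2 * k)) / 1"
      using WN[of N] nn by (intro divide_left_mono) auto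
    also have "\<dots> \<le> c * (\<Sum>i\<in>UNIV. l (?\<alpha> i) + 1) + 1"
    proof -
      have "R (s 0) ^ (2 * k) \<le> 1" by (simp add: s power_0_left)
      with * show ?thesis unfolding div_by_1 by (rule add_mono)
    qed
    finally show "(\<integral>t. R t ^ (2 * k) \<partial>M N) \<le>
        real CARD('n) ^ (2 * k + 2) * (\<Sum>i\<in>UNIV. l (\<lambda>j. if j = i then 2 * k + 2 else 0) + 1) + 1"
      by (simp only: c_def m_def)
  qed
  then obtain C where C: "\<And>k N. 2 * k + 2 \<le> N + 4 \<Longrightarrow> (\<integral>t. R t ^ (2 * k) \<partial>M N) \<le> C k"
    by metis
  \<comment> \<open>From (2 r + 3)^2 \<le> 8 r^2 + 18, integrated with the moment bound for k =
    1.\<close>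
  define K where "K = 8 * C 1 + 18"
  have second: "(\<integral>t. t\<^sup>2 \<partial>M N) \<le> K" for N
  proof -
    have le: "(s x)\<^sup>2 \<le> 8 * (R (s x))\<^sup>2 + 18" for x
    proof -
      have "(s x)\<^sup>2 \<le> (2 * norm x + 3)\<^sup>2" using s(3,4) by (intro power_mono)
      also have "\<dots> \<le> 8 * (norm x)\<^sup>2 + 18"
        using zero_le_power2[of "2 * norm x - 3"] by (simp add: power2_eq_square algebra_simps)
      finally show ?thesis by (simp add: s)
    qed
    have "(\<integral>t. t\<^sup>2 \<partial>M N) = ((\<Sum>x\<in>S N. u N x * (s x)\<^sup>2) + (s 0)\<^sup>2) / WN N"
      by (rule M_eq) measurable
    also have "\<dots> \<le> ((\<Sum>x\<in>S N. u N x * (8 * (R (s x))\<^sup>2 + 18)) + (8 * (R (s 0))\<^sup>2 + 18)) / WN N"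
      using WN[of N] by (intro divide_right_mono add_mono sum_mono mult_left_mono le u) auto
    also have "\<dots> = (\<integral>t. 8 * (R t)\<^sup>2 + 18 \<partial>M N)"
      by (rule M_eq[symmetric]) measurable
    also have "\<dots> = 8 * (\<integral>t. (R t)\<^sup>2 \<partial>M N) + 18"
    proof -
      interpret M: real_distribution "M N" by (rule M)
      show ?thesis by (subst Bochner_Integration.integral_add) (auto intro!: M_int simp: M.prob_space[unfolded M.space_eq_univ])
    qed
    also have "\<dots> \<le> K" using C[of 1 N] by (simp add: K_def)
    finally show ?thesis .
  qed
  have "tight M"
    unfolding tight_def
  proof (intro conjI allI impI M)
    fix e :: real assume "e > 0"
    \<comment> \<open>Chebyshev's inequality needs b^2 > K / e; the summand 1 makes this strict and
      b positive also for K = 0.\<close>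
    define b where "b = sqrt (K / e) + 1"
    have "0 \<le> K" by (rule order_trans[OF _ second[of 0]]) simp
    then have "b > 0" using \<open>e > 0\<close> by (auto simp: b_def intro!: add_nonneg_pos)
    have "K / e < b\<^sup>2"
      using \<open>0 \<le> K\<close> \<open>e > 0\<close> by (simp add: b_def power2_sum add_pos_nonneg)
    then have Kb: "K / b\<^sup>2 < e" using \<open>b > 0\<close> \<open>e > 0\<close> by (simp add: field_simps)
    have "1 - e < measure (M N) {- b<..b}" for N
    proof -
      interpret M: real_distribution "M N" by (rule M)
      have "1 - K / b\<^sup>2 \<le> 1 - (\<integral>t. t\<^sup>2 \<partial>M N) / b\<^sup>2"
        using second[of N] by (simp add: divide_right_mono)
      also have "\<dots> = (\<integral>t. 1 - t\<^sup>2 / b\<^sup>2 \<partial>M N)"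
        by (subst Bochner_Integration.integral_diff) (auto intro!: M_int simp: M.prob_space[unfolded M.space_eq_univ])
      also have "\<dots> \<le> (\<integral>t. indicator {- b<..b} t \<partial>M N)"
      proof (intro integral_mono M_int)
        fix t
        show "1 - t\<^sup>2 / b\<^sup>2 \<le> indicator {- b<..b} t"
        proof (cases "t \<in> {- b<..b}")
          case False
          then have "b\<^sup>2 \<le> t\<^sup>2" using \<open>b > 0\<close> by (subst abs_le_square_iff[symmetric]) auto
          then show ?thesis using False \<open>b > 0\<close> by simp
        qed simp
      qed measurable
      also have "\<dots> = measure (M N) {- b<..b}" by simp
      finally show ?thesis using Kb by simp
    qed
    then show "\<exists>a b. a < b \<and> (\<forall>n. 1 - e < measure (M n) {a<..b})"
      using \<open>b > 0\<close> by (intro exI[of _ "- b"] exI[of _ b]) auto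
  qed
  then obtain r M' where r: "strict_mono r" and M': "real_distribution M'" and wc: "weak_conv_m (\<lambda>n. M (r n)) M'"
    using tight_imp_convergent_subsubsequence[of M id] by (auto simp: strict_mono_id comp_def id_def)
  have F_sq: "(F \<alpha> t)\<^sup>2 \<le> R t ^ (2 * (mdeg \<alpha> - 2))" for \<alpha> t
  proof -
    have "\<bar>mono_eval \<alpha> (\<Theta> t)\<bar> \<le> 1" using mono_eval_bound[of "\<Theta> t" 1 \<alpha> "mdeg \<alpha>"] \<Theta>_le by simp
    then have "(mono_eval \<alpha> (\<Theta> t))\<^sup>2 \<le> 1" by (simp add: abs_square_le_1)
    then have "(R t ^ (mdeg \<alpha> - 2))\<^sup>2 * (mono_eval \<alpha> (\<Theta> t))\<^sup>2 \<le> (R t ^ (mdeg \<alpha> - 2))\<^sup>2 * 1"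
      by (intro mult_left_mono) auto
    then show ?thesis by (simp add: F_def power_mult_distrib power_mult[symmetric] mult.commute)
  qed
  have lim: "integrable M' (F \<alpha>)" "(\<lambda>n. \<integral>t. F \<alpha> t \<partial>M (r n)) \<longlonglongrightarrow> (\<integral>t. F \<alpha> t \<partial>M')" for \<alpha>
  proof -
    have isCont: "isCont (F \<alpha>) x" for x using F_cont by (simp add: continuous_on_eq_continuous_at)
    have bound: "\<forall>\<^sub>F n in sequentially. (\<integral>t. (F \<alpha> t)\<^sup>2 \<partial>M (r n)) \<le> C (mdeg \<alpha> - 2)"
      unfolding eventually_sequentially
    proof (intro exI allI impI)
      \<comment> \<open>The squared integrand is dominated by a moment of degree 2 * mdeg \<alpha> -
        2, which is controlled only from some stage on.\<close>
      fix n assume "2 * mdeg \<alpha> \<le> n"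
      then have "2 * (mdeg \<alpha> - 2) + 2 \<le> r n + 4" using seq_suble[OF r, of n] by simp
      then have "(\<integral>t. R t ^ (2 * (mdeg \<alpha> - 2)) \<partial>M (r n)) \<le> C (mdeg \<alpha> - 2)" by (rule C)
      moreover have "(\<integral>t. (F \<alpha> t)\<^sup>2 \<partial>M (r n)) \<le> (\<integral>t. R t ^ (2 * (mdeg \<alpha> - 2)) \<partial>M (r n))"
        by (intro integral_mono M_int F_sq) measurable
      ultimately show "(\<integral>t. (F \<alpha> t)\<^sup>2 \<partial>M (r n)) \<le> C (mdeg \<alpha> - 2)" by simp
    qed
    have int: "integrable (M (r n)) (\<lambda>t. (F \<alpha> t)\<^sup>2)" for n by (intro M_int) measurable
    note * = weak_conv_integral_L2_bounded[of "\<lambda>n. M (r n)", OF M M' wc isCont int bound]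
    show "integrable M' (F \<alpha>)" "(\<lambda>n. \<integral>t. F \<alpha> t \<partial>M (r n)) \<longlonglongrightarrow> (\<integral>t. F \<alpha> t \<partial>M')"
      by (rule *)+
  qed
  show thesis
  proof (rule that[OF M' cont])
    show "0 < W" using \<open>1 \<le> W\<close> by simp
    fix \<alpha> :: "'n \<Rightarrow> nat" assume \<alpha>: "2 \<le> mdeg \<alpha>"
    show "integrable M' (\<lambda>t. R t ^ (mdeg \<alpha> - 2) * mono_eval \<alpha> (\<Theta> t))"
      using lim(1)[of \<alpha>] by (simp only: F_def[abs_def])
    have "(\<integral>t. F \<alpha> t \<partial>M') = l \<alpha> / W"
      using LIMSEQ_unique[OF lim(2) LIMSEQ_subseq_LIMSEQ[OF F_lim[OF \<alpha>] r, unfolded comp_def]] .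
    then show "l \<alpha> = W * (\<integral>t. R t ^ (mdeg \<alpha> - 2) * mono_eval \<alpha> (\<Theta> t) \<partial>M')"
      using \<open>0 < W\<close> by (simp add: F_def)
  qed
qed

section \<open>Splitting the limit by its radius\<close>

lemma pos_min_imp_levy:
  fixes a :: "('n::finite \<Rightarrow> nat) \<Rightarrow> 'n mpoly" and y :: "real^'n"
  assumes pm: "pos_min a y"
  shows "\<exists>(\<Sigma>::real^'n^'n) (b::real^'n) (\<nu>::(real^'n) measure).
        psd \<Sigma> \<and> sets \<nu> = sets borel \<and>
        (\<forall>i. set_integrable \<nu> {x. 1 \<le> norm x} (\<lambda>x. x $ i)) \<and>
        (\<forall>\<alpha>. 2 \<le> mdeg \<alpha> \<longrightarrow> integrable \<nu> (\<lambda>x. \<bar>mono_eval \<alpha> x\<bar>)) \<and>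
        (\<forall>i. poly_eval (a (unitv i)) y = b $ i + (LINT x:{x. 1 \<le> norm x}|\<nu>. x $ i)) \<and>
        (\<forall>i j. poly_eval (a (unitv i + unitv j)) y =
                 \<Sigma> $ i $ j + (LINT x|\<nu>. mono_eval (unitv i + unitv j) x)) \<and>
        (\<forall>\<alpha>. 3 \<le> mdeg \<alpha> \<longrightarrow> poly_eval (a \<alpha>) y = (LINT x|\<nu>. mono_eval \<alpha> x))"
proof -
  define l where "l \<alpha> = poly_eval (a \<alpha>) y" for \<alpha>
  have pos: "0 \<le> (\<Sum>\<alpha>\<in>J. v \<alpha> * l \<alpha>)"
    if J: "finite J" "\<And>\<alpha>. \<alpha> \<in> J \<Longrightarrow> 2 \<le> mdeg \<alpha>"
      and nonneg: "\<And>z :: real^'n. 0 \<le> (\<Sum>\<alpha>\<in>J. v \<alpha> * mono_eval \<alpha> z)" for J v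
  proof -
    have "0 < mdeg \<alpha>" if "\<alpha> \<in> J" for \<alpha> using J(2)[OF that] by simp
    then show ?thesis unfolding l_def by (intro pos_min_functional[OF pm J(1) _ nonneg])
  qed
  obtain M :: "real measure" and \<Theta> :: "real \<Rightarrow> real^'n" and R W where
    M: "real_distribution M" and cont: "continuous_on UNIV \<Theta>" "continuous_on UNIV R" and W: "(0::real) < W"
    and int: "\<And>\<alpha>. 2 \<le> mdeg \<alpha> \<Longrightarrow> integrable M (\<lambda>t. R t ^ (mdeg \<alpha> - 2) * mono_eval \<alpha> (\<Theta> t))"
    and l_eq: "\<And>\<alpha>. 2 \<le> mdeg \<alpha> \<Longrightarrow> l \<alpha> = W * (\<integral>t. R t ^ (mdeg \<alpha> - 2) * mono_eval \<alpha> (\<Theta> t) \<partial>M)"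
    using moment_limit[of l, OF pos] by blast
  interpret M: real_distribution M by (rule M)
  have [measurable]: "R \<in> borel_measurable borel" "\<Theta> \<in> borel_measurable borel"
    using cont by (auto intro: borel_measurable_continuous_onI)
  have Z [measurable]: "{t. R t = 0} \<in> sets borel" "{t. R t \<noteq> 0} \<in> sets borel" by measurable
  define F where "F \<alpha> t = R t ^ (mdeg \<alpha> - 2) * mono_eval \<alpha> (\<Theta> t)" for \<alpha> t
  have F_int: "integrable M (F \<alpha>)" if "2 \<le> mdeg \<alpha>" for \<alpha>
    using int[OF that] by (simp only: F_def[abs_def])
  have F_ind: "integrable M (\<lambda>t. F \<alpha> t * indicator A t)" if "2 \<le> mdeg \<alpha>" "A \<in> sets borel" for \<alpha> A
    using integrable_mult_indicator[OF _ F_int[OF that(1)], of A] that(2) by (simp add: mult.commute)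
  \<comment> \<open>Undoes the normalisation by W and the weight |x|^2. The value 0 at radius zero
    keeps the Gaussian part out of \<nu>; elsewhere D may be unbounded, which accounts for infinite
    mass near the origin.\<close>
  define D where "D t = (if R t = 0 then 0 else W / (R t)\<^sup>2)" for t
  have D_nonneg: "0 \<le> D t" for t using W by (simp add: D_def)
  have [measurable]: "D \<in> borel_measurable borel" unfolding D_def[abs_def] by measurable
  define \<nu> where "\<nu> = distr (density M (\<lambda>t. ennreal (D t))) borel (\<lambda>t. R t *\<^sub>R \<Theta> t)"
  have sets_\<nu> [measurable_cong]: "sets \<nu> = sets borel" by (simp add: \<nu>_def)
  have D_mono: "D t * mono_eval \<alpha> (R t *\<^sub>R \<Theta> t) = W * (F \<alpha> t * indicator {t. R t \<noteq> 0} t)"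
    if "2 \<le> mdeg \<alpha>" for \<alpha> t
  proof (cases "R t = 0")
    case False
    have "R t ^ mdeg \<alpha> = (R t)\<^sup>2 * R t ^ (mdeg \<alpha> - 2)"
    proof -
      have "mdeg \<alpha> = 2 + (mdeg \<alpha> - 2)" using that by simp
      then show ?thesis by (metis power_add)
    qed
    then show ?thesis using False by (simp add: D_def F_def mono_eval_scaleR)
  qed (simp add: D_def)
  have \<nu>_integrable: "integrable \<nu> (mono_eval \<alpha>)" if "2 \<le> mdeg \<alpha>" for \<alpha>
    unfolding \<nu>_def using W F_ind[OF that Z(2)]
    by (subst integrable_distr_eq, simp, simp, subst integrable_density)
       (auto simp: D_nonneg D_mono[OF that])
  have \<nu>_integral: "(LINT x|\<nu>. mono_eval \<alpha> x) = W * (\<integral>t. F \<alpha> t * indicator {t. R t \<noteq> 0} t \<partial>M)"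
    if "2 \<le> mdeg \<alpha>" for \<alpha>
    unfolding \<nu>_def
    by (subst integral_distr, simp, simp, subst integral_density)
       (auto simp: D_nonneg D_mono[OF that])
  \<comment> \<open>In degree 2 the power of R in F is 0^0 = 1, so directions at radius zero still
    contribute; from degree 3 on a positive power of R removes them.\<close>
  define \<Sigma> :: "real^'n^'n" where
    "\<Sigma> = (\<chi> i j. W * (\<integral>t. F (unitv i + unitv j) t * indicator {t. R t = 0} t \<partial>M))"
  define b :: "real^'n" where "b = (\<chi> i. l (unitv i) - (LINT x:{x. 1 \<le> norm x}|\<nu>. x $ i))"
  have deg2: "2 \<le> mdeg (unitv i + unitv j)" for i j :: 'n by (simp add: mdeg_add)
  have F2: "F (unitv i + unitv j) t = \<Theta> t $ i * \<Theta> t $ j" for i j t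
    by (simp add: F_def mdeg_add mono_eval_add)
  have "psd \<Sigma>"
    unfolding psd_def
  proof (intro conjI allI)
    show "transpose \<Sigma> = \<Sigma>" by (simp add: transpose_def \<Sigma>_def vec_eq_iff add.commute)
    fix v :: "real^'n"
    \<comment> \<open>Up to W, \<Sigma> integrates the outer products of \<Theta> with itself over
      radius zero, so its quadratic form integrates a square.\<close>
    have "v \<bullet> (\<Sigma> *v v) = (\<Sum>i\<in>UNIV. \<Sum>j\<in>UNIV. W * (\<integral>t. v $ i * v $ j * (F (unitv i + unitv j) t * indicator {t. R t = 0} t) \<partial>M))"
      by (simp add: inner_vec_def matrix_vector_mult_def \<Sigma>_def sum_distrib_left mult_ac)
    also have "\<dots> = W * (\<integral>t. (\<Sum>i\<in>UNIV. \<Sum>j\<in>UNIV. v $ i * v $ j * (F (unitv i + unitv j) t * indicator {t. R t = 0} t)) \<partial>M)"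
      using F_ind[OF deg2 Z(1)]
      by (subst Bochner_Integration.integral_sum, simp, subst Bochner_Integration.integral_sum)
         (auto simp: sum_distrib_left)
    also have "\<dots> = W * (\<integral>t. (\<Sum>i\<in>UNIV. v $ i * \<Theta> t $ i)\<^sup>2 * indicator {t. R t = 0} t \<partial>M)"
    proof -
      have "(\<Sum>i\<in>UNIV. v $ i * \<Theta> t $ i)\<^sup>2 * c = (\<Sum>i\<in>UNIV. \<Sum>j\<in>UNIV. v $ i * \<Theta> t $ i * (v $ j * \<Theta> t $ j) * c)"
        for t c
        unfolding power2_eq_square sum_product by (simp only: sum_distrib_right)
      then show ?thesis by (simp only: F2 mult_ac)
    qed
    also have "\<dots> \<ge> 0" using W by (intro mult_nonneg_nonneg integral_nonneg_AE) auto
    finally show "0 \<le> v \<bullet> (\<Sigma> *v v)" .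
  qed
  moreover have "integrable \<nu> (\<lambda>x. \<bar>mono_eval \<alpha> x\<bar>)" if "2 \<le> mdeg \<alpha>" for \<alpha>
    by (intro integrable_abs \<nu>_integrable that)
  moreover have "set_integrable \<nu> {x. 1 \<le> norm x} (\<lambda>x. x $ i)" for i
    unfolding set_integrable_def
  proof (rule Bochner_Integration.integrable_bound)
    \<comment> \<open>The dominating function is |x|^2, which is at least |x_i| once |x| \<ge>
      1.\<close>
    show "integrable \<nu> (\<lambda>x. \<Sum>i\<in>UNIV. mono_eval (unitv i + unitv i) x)"
      by (intro Bochner_Integration.integrable_sum \<nu>_integrable deg2)
    show "(\<lambda>x. indicat_real {x. 1 \<le> norm x} x *\<^sub>R x $ i) \<in> borel_measurable \<nu>" by measurable
    show "AE x in \<nu>. norm (indicat_real {x. 1 \<le> norm x} x *\<^sub>R x $ i)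
        \<le> norm (\<Sum>i\<in>UNIV. mono_eval (unitv i + unitv i) x)"
    proof (rule AE_I2)
      fix x :: "real^'n"
      have "\<bar>x $ i\<bar> \<le> (norm x)\<^sup>2" if "1 \<le> norm x"
        using component_le_norm_cart[of x i] self_le_power[OF that, of 2] by simp
      then show "norm (indicat_real {x. 1 \<le> norm x} x *\<^sub>R x $ i)
        \<le> norm (\<Sum>i\<in>UNIV. mono_eval (unitv i + unitv i) x)"
        by (simp add: norm_square_eq[symmetric] indicator_def)
    qed
  qed
  moreover have "poly_eval (a (unitv i)) y = b $ i + (LINT x:{x. 1 \<le> norm x}|\<nu>. x $ i)" for i
    by (simp add: b_def l_def)
  moreover have "poly_eval (a (unitv i + unitv j)) y =
      \<Sigma> $ i $ j + (LINT x|\<nu>. mono_eval (unitv i + unitv j) x)" for i j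
  proof -
    let ?\<alpha> = "unitv i + unitv j"
    have "l ?\<alpha> = W * (\<integral>t. F ?\<alpha> t \<partial>M)"
      using l_eq[OF deg2] by (simp only: F_def)
    also have "(\<integral>t. F ?\<alpha> t \<partial>M) = (\<integral>t. F ?\<alpha> t * indicator {t. R t = 0} t + F ?\<alpha> t * indicator {t. R t \<noteq> 0} t \<partial>M)"
      by (intro Bochner_Integration.integral_cong refl) (auto simp: indicator_def)
    also have "\<dots> = (\<integral>t. F ?\<alpha> t * indicator {t. R t = 0} t \<partial>M) + (\<integral>t. F ?\<alpha> t * indicator {t. R t \<noteq> 0} t \<partial>M)"
      by (intro Bochner_Integration.integral_add F_ind deg2 Z)
    finally show ?thesis
      by (simp only: l_def[symmetric] \<nu>_integral[OF deg2] \<Sigma>_def vec_lambda_beta distrib_left)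
  qed
  moreover have "poly_eval (a \<alpha>) y = (LINT x|\<nu>. mono_eval \<alpha> x)" if "3 \<le> mdeg \<alpha>" for \<alpha>
  proof -
    have \<alpha>: "2 \<le> mdeg \<alpha>" using that by simp
    have "F \<alpha> t * indicator {t. R t \<noteq> 0} t = F \<alpha> t" for t
      using that by (cases "R t = 0") (auto simp: F_def power_0_left)
    then have "(LINT x|\<nu>. mono_eval \<alpha> x) = W * (\<integral>t. F \<alpha> t \<partial>M)"
      by (simp only: \<nu>_integral[OF \<alpha>])
    also have "\<dots> = poly_eval (a \<alpha>) y"
      using l_eq[OF \<alpha>] by (simp only: l_def F_def)
    finally show ?thesis ..
  qed
  ultimately show ?thesis
    using sets_\<nu> by (intro exI[of _ \<Sigma>] exI[of _ b] exI[of _ \<nu>]) blast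
qed

theorem theorem5p12:
  fixes a :: "('n::finite \<Rightarrow> nat) \<Rightarrow> 'n mpoly"
  assumes "\<forall>\<alpha>. deg_le (a \<alpha>) (mdeg \<alpha>)"
  shows "(\<forall>t::real. t \<ge> 0 \<longrightarrow> expA a t ` Pos \<subseteq> Pos) \<longleftrightarrow>
    (\<forall>y::real^'n. \<exists>(\<Sigma>::real^'n^'n) (b::real^'n) (\<nu>::(real^'n) measure).
        psd \<Sigma> \<and> sets \<nu> = sets borel \<and>
        (\<forall>i. set_integrable \<nu> {x. 1 \<le> norm x} (\<lambda>x. x $ i)) \<and>
        (\<forall>\<alpha>. 2 \<le> mdeg \<alpha> \<longrightarrow> integrable \<nu> (\<lambda>x. \<bar>mono_eval \<alpha> x\<bar>)) \<and>
        (\<forall>i. poly_eval (a (unitv i)) y = b $ i + (LINT x:{x. 1 \<le> norm x}|\<nu>. x $ i)) \<and>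
        (\<forall>i j. poly_eval (a (unitv i + unitv j)) y =
                 \<Sigma> $ i $ j + (LINT x|\<nu>. mono_eval (unitv i + unitv j) x)) \<and>
        (\<forall>\<alpha>. 3 \<le> mdeg \<alpha> \<longrightarrow> poly_eval (a \<alpha>) y = (LINT x|\<nu>. mono_eval \<alpha> x)))"
    (is "?preserver \<longleftrightarrow> (\<forall>y. ?levy y)")
proof
  assume ?preserver
  then show "\<forall>y. ?levy y" using pos_min_imp_levy[OF preserver_imp_pos_min[OF assms]] by blast
next
  assume levy: "\<forall>y. ?levy y"
  have "pos_min a y" for y
  proof -
    obtain \<Sigma> :: "real^'n^'n" and \<nu> :: "(real^'n) measure" where "psd \<Sigma>" "sets \<nu> = sets borel"
      "\<And>\<alpha>. 2 \<le> mdeg \<alpha> \<Longrightarrow> integrable \<nu> (\<lambda>x. \<bar>mono_eval \<alpha> x\<bar>)"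
      "\<And>i j. poly_eval (a (unitv i + unitv j)) y = \<Sigma> $ i $ j + (LINT x|\<nu>. mono_eval (unitv i + unitv j) x)"
      "\<And>\<alpha>. 3 \<le> mdeg \<alpha> \<Longrightarrow> poly_eval (a \<alpha>) y = (LINT x|\<nu>. mono_eval \<alpha> x)"
      using levy[rule_format, of y] by blast
    then show ?thesis by (rule levy_imp_pos_min)
  qed
  then show ?preserver using pos_min_imp_preserver[OF assms] by blast
qed

end
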